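(* Every element $W$ of $SB_n$ can be written uniquely in left-greedy form, and uniquely in right-greedy form.
   Context: Fix $n\ge 2$. $SB_n$ is the monoid with generators $\sigma_i,\sigma_i^{-1},x_i$ ($i=1,\dots,n-1$) and relations: $\sigma_i\sigma_j=\sigma_j\sigma_i$ and $x_ix_j=x_jx_i$ if $|i-j|>1$; $x_i\sigma_j=\sigma_jx_i$ if $|i-j|\ne1$; $\sigma_i\sigma_{i+1}\sigma_i=\sigma_{i+1}\sigma_i\sigma_{i+1}$; $\sigma_i\sigma_{i+1}x_i=x_{i+1}\sigma_i\sigma_{i+1}$; $\sigma_{i+1}\sigma_ix_{i+1}=x_i\sigma_{i+1}\sigma_i$; $\sigma_i\sigma_i^{-1}=\sigma_i^{-1}\sigma_i=1$. $SB_n^+$ is the monoid with generators $\sigma_i,x_i$ and all these relations except the last; $Br_n^+\subseteq SB_n^+$ is the submonoid generated by the $\sigma_i$. $\Delta=\sigma_1\cdots\sigma_{n-1}\,\sigma_1\cdots\sigma_{n-2}\cdots\sigma_1\sigma_2\,\sigma_1$. Left-greedy form of a positive braid $P\in Br_n^+$: $P=A_1\cdots A_r$ where each $A_j\ne1$ is a left divisor of $\Delta$ in $Br_n^+$ (a positive permutation braid) and each $A_j$ is the greatest common left divisor of $\Delta$ and $A_jA_{j+1}\cdots A_r$ (successive longest possible fragments of $\Delta$). Left-greedy form for $SB_n$: write $W=\Delta^tW'$ with $t\in\mathbb Z$ maximal and $W'\in SB_n^+$ not left divisible by $\Delta$ (Garside left normal form). Let $S_1$ be the greatest left divisor of $W'$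 lying in $Br_n^+$ and $W'=S_1T$; write $S_1$ in its left-greedy form. If $T\ne1$, let $x_{i_1}$ be the left divisor of $T$ among $x_1,\dots,x_{n-1}$ with smallest index and $T=x_{i_1}T_1$; then repeat with $T_1$ in place of $W'$ (greatest $Br_n^+$-left divisor, written in left-greedy form, then smallest $x$-left divisor, etc.). Grouping consecutive letters $x_j$ with no braid part between them yields an expression $W=\Delta^tS_1X_1\cdots S_kX_k$, where each $S_i$ is a product of left-greedy fragments of a positive braid and each $X_i$ is a product of letters $x_j$; this is called the left-greedy form of $W$. The right-greedy form is defined symmetrically (with right divisors, reading from the right). *)

theory Defs
  imports Main
begin

text \<open>Letters: Sg i = sigma_i, Sinv i = sigma_i^{-1}, Xg i = x_i  (1 <= i <= n-1).\<close>
datatype gen = Sg nat | Sinv nat | Xg nat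

definition idx_ok :: "nat \<Rightarrow> nat \<Rightarrow> bool" where
  "idx_ok n i \<longleftrightarrow> 1 \<le> i \<and> i < n"

fun letter_ok :: "nat \<Rightarrow> gen \<Rightarrow> bool" where
  "letter_ok n (Sg i) = idx_ok n i"
| "letter_ok n (Sinv i) = idx_ok n i"
| "letter_ok n (Xg i) = idx_ok n i"

definition sb_word :: "nat \<Rightarrow> gen list \<Rightarrow> bool" where
  "sb_word n w \<longleftrightarrow> (\<forall>g\<in>set w. letter_ok n g)"

definition pos_word :: "nat \<Rightarrow> gen list \<Rightarrow> bool" where
  "pos_word n w \<longleftrightarrow> (\<forall>g\<in>set w. letter_ok n g \<and> (\<forall>i. g \<noteq> Sinv i))"

text \<open>Words in the generators sigma_i only (they generate Br_n^+ inside SB_n^+).\<close>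
definition braid_word :: "nat \<Rightarrow> gen list \<Rightarrow> bool" where
  "braid_word n w \<longleftrightarrow> (\<forall>g\<in>set w. \<exists>i. idx_ok n i \<and> g = Sg i)"

inductive_set pos_rel :: "nat \<Rightarrow> (gen list \<times> gen list) set" for n where
  ss: "idx_ok n i \<Longrightarrow> idx_ok n j \<Longrightarrow> i + 1 < j \<or> j + 1 < i \<Longrightarrow>
       ([Sg i, Sg j], [Sg j, Sg i]) \<in> pos_rel n"
| xx: "idx_ok n i \<Longrightarrow> idx_ok n j \<Longrightarrow> i + 1 < j \<or> j + 1 < i \<Longrightarrow>
       ([Xg i, Xg j], [Xg j, Xg i]) \<in> pos_rel n"
| xs: "idx_ok n i \<Longrightarrow> idx_ok n j \<Longrightarrow> i \<noteq> j + 1 \<Longrightarrow> j \<noteq> i + 1 \<Longrightarrow>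
       ([Xg i, Sg j], [Sg j, Xg i]) \<in> pos_rel n"
| sss: "idx_ok n i \<Longrightarrow> idx_ok n (i + 1) \<Longrightarrow>
       ([Sg i, Sg (i + 1), Sg i], [Sg (i + 1), Sg i, Sg (i + 1)]) \<in> pos_rel n"
| ssx1: "idx_ok n i \<Longrightarrow> idx_ok n (i + 1) \<Longrightarrow>
       ([Sg i, Sg (i + 1), Xg i], [Xg (i + 1), Sg i, Sg (i + 1)]) \<in> pos_rel n"
| ssx2: "idx_ok n i \<Longrightarrow> idx_ok n (i + 1) \<Longrightarrow>
       ([Sg (i + 1), Sg i, Xg (i + 1)], [Xg i, Sg (i + 1), Sg i]) \<in> pos_rel n"

inductive_set inv_rel :: "nat \<Rightarrow> (gen list \<times> gen list) set" for n where
  "idx_ok n i \<Longrightarrow> ([Sg i, Sinv i], []) \<in> inv_rel n"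
| "idx_ok n i \<Longrightarrow> ([Sinv i, Sg i], []) \<in> inv_rel n"

inductive mon_cong :: "(gen list \<times> gen list) set \<Rightarrow> gen list \<Rightarrow> gen list \<Rightarrow> bool"
  for R where
  rel: "(l, r) \<in> R \<Longrightarrow> mon_cong R (u @ l @ v) (u @ r @ v)"
| refl: "mon_cong R w w"
| sym: "mon_cong R u v \<Longrightarrow> mon_cong R v u"
| trans: "mon_cong R u v \<Longrightarrow> mon_cong R v w \<Longrightarrow> mon_cong R u w"

definition peq :: "nat \<Rightarrow> gen list \<Rightarrow> gen list \<Rightarrow> bool" where
  "peq n = mon_cong (pos_rel n)"

definition geq :: "nat \<Rightarrow> gen list \<Rightarrow> gen list \<Rightarrow> bool" where
  "geq n = mon_cong (pos_rel n \<union> inv_rel n)"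

definition pcls :: "nat \<Rightarrow> gen list \<Rightarrow> gen list set" where
  "pcls n w = {v. pos_word n v \<and> peq n w v}"

definition pdvd :: "nat \<Rightarrow> gen list \<Rightarrow> gen list \<Rightarrow> bool" where
  "pdvd n a b \<longleftrightarrow> (\<exists>c. pos_word n c \<and> peq n (a @ c) b)"

definition rpdvd :: "nat \<Rightarrow> gen list \<Rightarrow> gen list \<Rightarrow> bool" where
  "rpdvd n a b \<longleftrightarrow> (\<exists>c. pos_word n c \<and> peq n (c @ a) b)"

definition bdvd :: "nat \<Rightarrow> gen list \<Rightarrow> gen list \<Rightarrow> bool" where
  "bdvd n a b \<longleftrightarrow> (\<exists>c. braid_word n c \<and> peq n (a @ c) b)"

definition rbdvd :: "nat \<Rightarrow> gen list \<Rightarrow> gen list \<Rightarrow> bool" where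
  "rbdvd n a b \<longleftrightarrow> (\<exists>c. braid_word n c \<and> peq n (c @ a) b)"

definition delta :: "nat \<Rightarrow> gen list" where
  "delta n = concat (map (\<lambda>m. map Sg [1..<m + 1]) (rev [1..<n]))"

fun ginv :: "gen \<Rightarrow> gen" where
  "ginv (Sg i) = Sinv i"
| "ginv (Sinv i) = Sg i"
| "ginv (Xg i) = Xg i"

definition delta_pow :: "nat \<Rightarrow> int \<Rightarrow> gen list" where
  "delta_pow n t = (if 0 \<le> t then concat (replicate (nat t) (delta n))
                    else concat (replicate (nat (- t)) (rev (map ginv (delta n)))))"

text \<open>A factor of a greedy form: a braid fragment (an element of Br_n^+, given as its
  class in SB_n^+) or a letter x_i.\<close>
datatype factor = Frag "gen list set" | Xf nat

definition fword :: "factor \<Rightarrow> gen list" where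
  "fword f = (case f of Frag A \<Rightarrow> (SOME w. w \<in> A) | Xf i \<Rightarrow> [Xg i])"

definition fprod :: "factor list \<Rightarrow> gen list" where
  "fprod fs = concat (map fword fs)"

definition is_frag :: "nat \<Rightarrow> factor \<Rightarrow> bool" where
  "is_frag n f \<longleftrightarrow> (\<exists>a. braid_word n a \<and> f = Frag (pcls n a))"

definition left_greedy_braid :: "nat \<Rightarrow> factor list \<Rightarrow> bool" where
  "left_greedy_braid n As \<longleftrightarrow> (\<forall>f\<in>set As. is_frag n f) \<and>
     (\<forall>j < length As.
        \<not> peq n (fword (As ! j)) [] \<and>
        bdvd n (fword (As ! j)) (delta n) \<and>
        bdvd n (fword (As ! j)) (fprod (drop j As)) \<and>
        (\<forall>b. braid_word n b \<longrightarrow> bdvd n b (delta n) \<longrightarrow> bdvd n b (fprod (drop j As))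
              \<longrightarrow> bdvd n b (fword (As ! j))))"

definition right_greedy_braid :: "nat \<Rightarrow> factor list \<Rightarrow> bool" where
  "right_greedy_braid n As \<longleftrightarrow> (\<forall>f\<in>set As. is_frag n f) \<and>
     (\<forall>j < length As.
        \<not> peq n (fword (As ! j)) [] \<and>
        rbdvd n (fword (As ! j)) (delta n) \<and>
        rbdvd n (fword (As ! j)) (fprod (take (Suc j) As)) \<and>
        (\<forall>b. braid_word n b \<longrightarrow> rbdvd n b (delta n) \<longrightarrow> rbdvd n b (fprod (take (Suc j) As))
              \<longrightarrow> rbdvd n b (fword (As ! j))))"

definition greatest_braid_ldiv :: "nat \<Rightarrow> gen list \<Rightarrow> gen list \<Rightarrow> bool" where
  "greatest_braid_ldiv n s T \<longleftrightarrow> pdvd n s T \<and>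
     (\<forall>s'. braid_word n s' \<longrightarrow> pdvd n s' T \<longrightarrow> pdvd n s' s)"

definition greatest_braid_rdiv :: "nat \<Rightarrow> gen list \<Rightarrow> gen list \<Rightarrow> bool" where
  "greatest_braid_rdiv n s T \<longleftrightarrow> rpdvd n s T \<and>
     (\<forall>s'. braid_word n s' \<longrightarrow> rpdvd n s' T \<longrightarrow> rpdvd n s' s)"

definition min_x_ldiv :: "nat \<Rightarrow> nat \<Rightarrow> gen list \<Rightarrow> bool" where
  "min_x_ldiv n i T \<longleftrightarrow> idx_ok n i \<and> pdvd n [Xg i] T \<and>
     (\<forall>j. idx_ok n j \<longrightarrow> j < i \<longrightarrow> \<not> pdvd n [Xg j] T)"

definition min_x_rdiv :: "nat \<Rightarrow> nat \<Rightarrow> gen list \<Rightarrow> bool" where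
  "min_x_rdiv n i T \<longleftrightarrow> idx_ok n i \<and> rpdvd n [Xg i] T \<and>
     (\<forall>j. idx_ok n j \<longrightarrow> j < i \<longrightarrow> \<not> rpdvd n [Xg j] T)"

inductive lg_tail :: "nat \<Rightarrow> factor list \<Rightarrow> bool" for n where
  last: "left_greedy_braid n As \<Longrightarrow> greatest_braid_ldiv n (fprod As) (fprod As)
         \<Longrightarrow> lg_tail n As"
| step: "left_greedy_braid n As \<Longrightarrow>
         greatest_braid_ldiv n (fprod As) (fprod (As @ Xf i # rest)) \<Longrightarrow>
         min_x_ldiv n i (fprod (Xf i # rest)) \<Longrightarrow>
         lg_tail n rest \<Longrightarrow> lg_tail n (As @ Xf i # rest)"

inductive rg_tail :: "nat \<Rightarrow> factor list \<Rightarrow> bool" for n where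
  last: "right_greedy_braid n As \<Longrightarrow> greatest_braid_rdiv n (fprod As) (fprod As)
         \<Longrightarrow> rg_tail n As"
| step: "right_greedy_braid n As \<Longrightarrow>
         greatest_braid_rdiv n (fprod As) (fprod (rest @ Xf i # As)) \<Longrightarrow>
         min_x_rdiv n i (fprod (rest @ [Xf i])) \<Longrightarrow>
         rg_tail n rest \<Longrightarrow> rg_tail n (rest @ Xf i # As)"

definition left_greedy_form :: "nat \<Rightarrow> gen list \<Rightarrow> int \<times> factor list \<Rightarrow> bool" where
  "left_greedy_form n w F \<longleftrightarrow> (case F of (t, fs) \<Rightarrow>
     lg_tail n fs \<and>
     geq n w (delta_pow n t @ fprod fs) \<and>
     \<not> pdvd n (delta n) (fprod fs) \<and>
     (\<forall>s v. pos_word n v \<longrightarrow> geq n w (delta_pow n s @ v) \<longrightarrow> s \<le> t))"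

definition right_greedy_form :: "nat \<Rightarrow> gen list \<Rightarrow> int \<times> factor list \<Rightarrow> bool" where
  "right_greedy_form n w F \<longleftrightarrow> (case F of (t, fs) \<Rightarrow>
     rg_tail n fs \<and>
     geq n w (fprod fs @ delta_pow n t) \<and>
     \<not> rpdvd n (delta n) (fprod fs) \<and>
     (\<forall>s v. pos_word n v \<longrightarrow> geq n w (v @ delta_pow n s) \<longrightarrow> s \<le> t))"

end

theory Submission
  imports Defs
begin

text \<open>
  Everything rests on Garside's argument for \<open>SB\<^sub>n\<^sup>+\<close>. For letters \<open>a\<close>, \<open>b\<close> let \<open>p\<close>, \<open>q\<close> be the
  complements with \<open>a p = b q\<close> read off the unique defining relation between them (neighbouring
  letters x have no complement and no common multiple). If \<open>a u = b v\<close>, then \<open>u = p w\<close> and \<open>v = q w\<close>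
  for some \<open>w\<close>; this is proved by induction on the length and along a chain of elementary
  transformations, and the passage through an intermediate first letter \<open>c\<close> is a cube condition,
  which depends only on the adjacency pattern of the three indices. Hence \<open>SB\<^sub>n\<^sup>+\<close> is left cancellative
  and braids with a common multiple have a least one, so greatest braid divisors exist and every
  greedy factor is determined by the element. As \<open>\<Delta>\<close> permutes the generators by conjugation, \<open>SB\<^sub>n\<close> is the
  localisation of \<open>SB\<^sub>n\<^sup>+\<close> at \<open>\<Delta>\<close>, and \<open>SB\<^sub>n\<^sup>+\<close> embeds in it; counting letters sigma bounds
  the exponent of \<open>\<Delta>\<close>. Reversing words exchanges left and right.
\<close>

section \<open>The Garside property of the positive monoid\<close>

lemma mon_cong_context: "mon_cong R u v \<Longrightarrow> mon_cong R (x @ u @ y) (x @ v @ y)"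
proof (induction rule: mon_cong.induct)
  case (rel l r u v)
  then show ?case
    using mon_cong.rel[of l r R "x @ u" "v @ y"] by simp
qed (blast intro: mon_cong.intros)+

lemma mon_cong_append:
  assumes "mon_cong R u u'" "mon_cong R v v'"
  shows "mon_cong R (u @ v) (u' @ v')"
  using mon_cong_context[OF assms(1), of "[]" v] mon_cong_context[OF assms(2), of u' "[]"]
  by (auto intro: mon_cong.trans)

lemma peq_refl [simp, intro]: "peq n u u"
  by (simp add: peq_def mon_cong.refl)

lemma peq_sym: "peq n u v \<Longrightarrow> peq n v u"
  by (simp add: peq_def mon_cong.sym)

lemma peq_trans [trans]: "peq n u v \<Longrightarrow> peq n v w \<Longrightarrow> peq n u w"
  unfolding peq_def by (rule mon_cong.trans)

lemma peq_append: "peq n u u' \<Longrightarrow> peq n v v' \<Longrightarrow> peq n (u @ v) (u' @ v')"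
  by (simp add: peq_def mon_cong_append)

lemma peq_Cons: "peq n u v \<Longrightarrow> peq n (a # u) (a # v)"
  using peq_append[of n "[a]" "[a]" u v] by simp

lemma peq_append_left: "peq n u v \<Longrightarrow> peq n (x @ u) (x @ v)"
  by (simp add: peq_append)

lemma peq_append_right: "peq n u v \<Longrightarrow> peq n (u @ x) (v @ x)"
  by (simp add: peq_append)

lemma peq_rel: "(l, r) \<in> pos_rel n \<Longrightarrow> peq n l r"
  using mon_cong.rel[of l r "pos_rel n" "[]" "[]"] by (simp add: peq_def)

lemma peq_eq_trans [trans]:
  "u = v \<Longrightarrow> peq n v w \<Longrightarrow> peq n u w" "peq n u v \<Longrightarrow> v = w \<Longrightarrow> peq n u w"
  by simp_all

lemma pos_word_simps [simp]:
  "pos_word n []"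
  "pos_word n (Sg i # u) \<longleftrightarrow> idx_ok n i \<and> pos_word n u"
  "pos_word n (Xg i # u) \<longleftrightarrow> idx_ok n i \<and> pos_word n u"
  "\<not> pos_word n (Sinv i # u)"
  "pos_word n (u @ v) \<longleftrightarrow> pos_word n u \<and> pos_word n v"
  by (auto simp: pos_word_def)

lemma pos_word_Cons: "pos_word n (a # u) \<longleftrightarrow> pos_word n [a] \<and> pos_word n u"
  by (auto simp: pos_word_def)

lemma braid_word_simps [simp]:
  "braid_word n []"
  "braid_word n (Sg i # u) \<longleftrightarrow> idx_ok n i \<and> braid_word n u"
  "\<not> braid_word n (Xg i # u)"
  "\<not> braid_word n (Sinv i # u)"
  "braid_word n (u @ v) \<longleftrightarrow> braid_word n u \<and> braid_word n v"
  by (auto simp: braid_word_def)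

lemma braid_imp_pos: "braid_word n u \<Longrightarrow> pos_word n u"
  by (auto simp: braid_word_def pos_word_def)

text \<open>Every defining relation is homogeneous, has positive sides, and has letters x on both
  sides or on neither. So elements have a length to induct on, and any representing word shows
  whether an element is a braid.\<close>

lemma peq_invariants:
  assumes "peq n u v"
  shows "length u = length v \<and> (pos_word n u \<longleftrightarrow> pos_word n v) \<and> (braid_word n u \<longleftrightarrow> braid_word n v)"
  using assms unfolding peq_def
proof (induction rule: mon_cong.induct)
  case (rel l r u v)
  then show ?case by (cases rule: pos_rel.cases) auto
qed auto

lemmas peq_length = peq_invariants[THEN conjunct1]
lemmas peq_pos_iff = peq_invariants[THEN conjunct2, THEN conjunct1]
lemmas peq_braid_iff = peq_invariants[THEN conjunct2, THEN conjunct2]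

section \<open>Complements of letters\<close>

definition adj :: "nat \<Rightarrow> nat \<Rightarrow> bool" where
  "adj i j \<longleftrightarrow> i = j + 1 \<or> j = i + 1"

lemma adj_sym: "adj i j \<longleftrightarrow> adj j i"
  by (auto simp: adj_def)

lemma adj_irrefl [simp]: "\<not> adj i i"
  by (simp add: adj_def)

lemma adj_no_triangle: "adj i j \<Longrightarrow> adj j k \<Longrightarrow> \<not> adj i k"
  by (auto simp: adj_def)

text \<open>Right complements: \<open>a # compl a b\<close> will be the least common right multiple
  of \<open>a\<close> and \<open>b\<close>. Since \<open>Sg i\<close> and \<open>Xg i\<close>
  commute, equal indices of different kinds fall under the non-adjacent case. The last equation only
  covers inverse letters, absent from positive words.\<close>

fun compl :: "gen \<Rightarrow> gen \<Rightarrow> gen list option" where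
  "compl (Sg i) (Sg j) = Some (if i = j then [] else if adj i j then [Sg j, Sg i] else [Sg j])"
| "compl (Sg i) (Xg j) = Some (if adj i j then [Sg j, Xg i] else [Xg j])"
| "compl (Xg i) (Sg j) = Some (if adj i j then [Sg j, Sg i] else [Sg j])"
| "compl (Xg i) (Xg j) = (if i = j then Some [] else if adj i j then None else Some [Xg j])"
| "compl _ _ = None"

lemma compl_self: "pos_word n [a] \<Longrightarrow> compl a a = Some []"
  by (cases a) auto

lemma compl_pos: "compl a b = Some p \<Longrightarrow> pos_word n [a] \<Longrightarrow> pos_word n [b] \<Longrightarrow> pos_word n p"
  by (cases a; cases b) (auto split: if_splits)

text \<open>\<open>ssx1\<close> and \<open>ssx2\<close> are exchanged by swapping the two
  neighbouring indices, so the symmetric \<open>adj\<close> merges them into one relation.\<close>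

lemma adj_braid_relations:
  assumes "adj i j" "idx_ok n i" "idx_ok n j"
  shows "peq n [Sg i, Sg j, Sg i] [Sg j, Sg i, Sg j]"
    and "peq n [Sg i, Sg j, Xg i] [Xg j, Sg i, Sg j]"
  using assms pos_rel.sss[of n i] pos_rel.sss[of n j] pos_rel.ssx1[of n i] pos_rel.ssx2[of n j]
  by (auto simp: adj_def intro: peq_rel peq_sym)

lemma nonadj_commute:
  assumes "\<not> adj i j" "idx_ok n i" "idx_ok n j"
  shows "peq n [Sg i, Sg j] [Sg j, Sg i]" "peq n [Xg i, Sg j] [Sg j, Xg i]" 
    "peq n [Xg i, Xg j] [Xg j, Xg i]"
proof -
  have *: "i = j \<or> i + 1 < j \<or> j + 1 < i" using assms by (auto simp: adj_def)
  show "peq n [Sg i, Sg j] [Sg j, Sg i]"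
    using assms pos_rel.ss[of n i j] * by (auto intro: peq_rel)
  show "peq n [Xg i, Xg j] [Xg j, Xg i]"
    using assms pos_rel.xx[of n i j] * by (auto intro: peq_rel)
  show "peq n [Xg i, Sg j] [Sg j, Xg i]"
    using assms pos_rel.xs[of n i j] by (auto intro: peq_rel simp: adj_def)
qed

lemma compl_peq:
  assumes "compl a b = Some p" "compl b a = Some q" "pos_word n [a]" "pos_word n [b]"
  shows "peq n (a # p) (b # q)"
  using assms
  by (cases a; cases b)
     (auto split: if_splits simp: adj_sym
       intro: adj_braid_relations nonadj_commute peq_sym peq_sym[OF adj_braid_relations(2)]
         peq_sym[OF nonadj_commute(2)])

text \<open>The complements are required to exist, so the predicate also excludes a common multiple
  of neighbouring letters x.\<close>

definition factors_through_lcm :: "nat \<Rightarrow> gen \<Rightarrow> gen list \<Rightarrow> gen \<Rightarrow> gen list \<Rightarrow> bool" where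
  "factors_through_lcm n a u b v \<longleftrightarrow> (\<exists>p q w. compl a b = Some p \<and> compl b a = Some q \<and>
     pos_word n w \<and> peq n u (p @ w) \<and> peq n v (q @ w))"

text \<open>
  Word reversing in continuation-passing style: \<open>k\<close> bounds the recursion depth, \<open>C\<close> receives the two
  words completing \<open>u\<close> and \<open>v\<close> to a common right multiple, and \<open>ok\<close> is the result when two
  neighbouring letters x meet, which have no common multiple.
\<close>

fun reversing :: "bool \<Rightarrow> nat \<Rightarrow> gen list \<Rightarrow> gen list \<Rightarrow> (gen list \<Rightarrow> gen list \<Rightarrow> bool) \<Rightarrow> bool" where
  "reversing ok 0 u v C \<longleftrightarrow> False"
| "reversing ok (Suc k) [] v C \<longleftrightarrow> C v []"
| "reversing ok (Suc k) (a # u) [] C \<longleftrightarrow> C [] (a # u)"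
| "reversing ok (Suc k) (a # u) (b # v) C \<longleftrightarrow>
    (case compl a b of None \<Rightarrow> ok | Some p \<Rightarrow> (case compl b a of None \<Rightarrow> ok | Some q \<Rightarrow>
      reversing ok k u p (\<lambda>p1 u1. reversing ok k v q (\<lambda>q1 v1.
        reversing ok k u1 v1 (\<lambda>v2 u2. C (p1 @ v2) (q1 @ u2))))))"

text \<open>With \<open>ok = False\<close> both a clash of letters x and exhausted depth make the
  run fail. A successful run has therefore closed every square of the reversing grid, and pasting
  the squares gives a common multiple.\<close>

lemma reversing_sound:
  assumes "reversing False k u v C" "pos_word n u" "pos_word n v"
  shows "\<exists>p q. C p q \<and> pos_word n p \<and> pos_word n q \<and> peq n (u @ p) (v @ q)"
  using assms
proof (induction k arbitrary: u v C)
  case 0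
  then show ?case by simp
next
  case (Suc k)
  consider "u = []" | a u' where "u = a # u'" "v = []" | a u' b v' where "u = a # u'" "v = b # v'"
    by (cases u; cases v) auto
  then show ?case
  proof cases
    case 1
    then have "C v []" using Suc.prems by simp
    then show ?thesis using 1 Suc.prems by (intro exI[of _ v] exI[of _ "[]"]) auto
  next
    case 2
    then have "C [] u" using Suc.prems by simp
    then show ?thesis using 2 Suc.prems by (intro exI[of _ "[]"] exI[of _ u]) auto
  next
    case 3
    then obtain p q where pq: "compl a b = Some p" "compl b a = Some q"
      and red: "reversing False k u' p (\<lambda>p1 u1. reversing False k v' q (\<lambda>q1 v1.
        reversing False k u1 v1 (\<lambda>v2 u2. C (p1 @ v2) (q1 @ u2))))"
      using Suc.prems by (auto split: option.splits)
    have pos: "pos_word n [a]" "pos_word n [b]" "pos_word n u'" "pos_word n v'"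
      using Suc.prems 3 pos_word_Cons by blast+
    then have pos': "pos_word n p" "pos_word n q" using pq compl_pos by blast+
    from Suc.IH[OF red pos(3) pos'(1)] obtain p1 u1 where 1:
      "reversing False k v' q (\<lambda>q1 v1. reversing False k u1 v1 (\<lambda>v2 u2. C (p1 @ v2) (q1 @ u2)))"
      "pos_word n p1" "pos_word n u1" "peq n (u' @ p1) (p @ u1)" by blast
    from Suc.IH[OF 1(1) pos(4) pos'(2)] obtain q1 v1 where 2:
      "reversing False k u1 v1 (\<lambda>v2 u2. C (p1 @ v2) (q1 @ u2))"
      "pos_word n q1" "pos_word n v1" "peq n (v' @ q1) (q @ v1)" by blast
    from Suc.IH[OF 2(1) 1(3) 2(3)] obtain v2 u2 where 4:
      "C (p1 @ v2) (q1 @ u2)" "pos_word n v2" "pos_word n u2" "peq n (u1 @ v2) (v1 @ u2)" by blast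
    have "peq n (a # u' @ p1 @ v2) (a # p @ u1 @ v2)"
      using peq_Cons[OF peq_append[OF 1(4) peq_refl[of n v2]]] by simp
    also have "peq n \<dots> (b # q @ v1 @ u2)"
      using peq_append[OF compl_peq[OF pq pos(1,2)] 4(4)] by simp
    also have "peq n \<dots> (b # v' @ q1 @ u2)"
      using peq_Cons[OF peq_append[OF peq_sym[OF 2(4)] peq_refl[of n u2]]] by simp
    finally show ?thesis using 3 4 1 2 
      by (intro exI[of _ "p1 @ v2"] exI[of _ "q1 @ u2"]) auto
  qed
qed

text \<open>Here a common multiple is given, and the run splits off the completions
  \<open>p\<close>, \<open>q\<close> from its cofactors. The Garside property is assumed only below
  length \<open>N\<close>, so that the lemma can serve inside the induction that proves it.\<close>

lemma reversing_common_multiple: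
  assumes garside: "\<And>a u b v. length (a # u) < N \<Longrightarrow> pos_word n (a # u) \<Longrightarrow> peq n (a # u) (b # v) \<Longrightarrow>
      factors_through_lcm n a u b v"
    and "reversing True k u v C" "peq n (u @ w1) (v @ w2)" "pos_word n (u @ w1)" "length (u @ w1) < N"
  shows "\<exists>p q w. C p q \<and> pos_word n w \<and> peq n w1 (p @ w) \<and> peq n w2 (q @ w)"
  using assms(2-)
proof (induction k arbitrary: u v w1 w2 C)
  case 0
  then show ?case by simp
next
  case (Suc k)
  have pos: "pos_word n (v @ w2)" "length (v @ w2) < N"
    using Suc.prems peq_pos_iff peq_length by metis+
  consider "u = []" | a u' where "u = a # u'" "v = []" | a u' b v' where "u = a # u'" "v = b # v'"
    by (cases u; cases v) auto
  then show ?case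
  proof cases
    case 1
    then have "C v []" using Suc.prems by simp
    then show ?thesis using 1 Suc.prems pos
      by (intro exI[of _ v] exI[of _ "[]"] exI[of _ w2]) auto
  next
    case 2
    then have "C [] u" using Suc.prems by simp
    moreover have "peq n w2 (u @ w1)" "pos_word n w1"
      using 2 Suc.prems pos_word_Cons[of n a "u' @ w1"] by (auto intro: peq_sym)
    ultimately show ?thesis
      by (metis append_Nil peq_refl)
  next
    case 3
    \<comment> \<open>This provides both complements, so the branch \<open>None\<close>, which
      \<open>reversing True\<close> accepts vacuously, cannot occur.\<close>
    have "factors_through_lcm n a (u' @ w1) b (v' @ w2)"
      using 3 Suc.prems by (intro garside) auto
    then obtain p q w where pq: "compl a b = Some p" "compl b a = Some q" "pos_word n w"
      "peq n (u' @ w1) (p @ w)" "peq n (v' @ w2) (q @ w)"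
      unfolding factors_through_lcm_def by blast
    have red: "reversing True k u' p (\<lambda>p1 u1. reversing True k v' q (\<lambda>q1 v1.
        reversing True k u1 v1 (\<lambda>v2 u2. C (p1 @ v2) (q1 @ u2))))"
      using Suc.prems 3 pq by simp
    have pos': "pos_word n (u' @ w1)" "length (u' @ w1) < N" "pos_word n (v' @ w2)" "length (v' @ w2) < N"
      using 3 Suc.prems pos pos_word_Cons[of n a "u' @ w1"] pos_word_Cons[of n b "v' @ w2"] by auto
    from Suc.IH[OF red pq(4) pos'(1,2)] obtain p1 u1 z where 1:
      "reversing True k v' q (\<lambda>q1 v1. reversing True k u1 v1 (\<lambda>v2 u2. C (p1 @ v2) (q1 @ u2)))"
      "pos_word n z" "peq n w1 (p1 @ z)" "peq n w (u1 @ z)" by blast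
    from Suc.IH[OF 1(1) pq(5) pos'(3,4)] obtain q1 v1 y where 2:
      "reversing True k u1 v1 (\<lambda>v2 u2. C (p1 @ v2) (q1 @ u2))"
      "pos_word n y" "peq n w2 (q1 @ y)" "peq n w (v1 @ y)" by blast
    have "length w \<le> length (u' @ w1)" using peq_length[OF pq(4)] by simp
    then have "pos_word n (u1 @ z)" "length (u1 @ z) < N"
      using 1(4) pq(3) pos'(2) peq_pos_iff[OF 1(4)] peq_length[OF 1(4)] by auto
    from Suc.IH[OF 2(1) peq_trans[OF peq_sym[OF 1(4)] 2(4)] this] obtain v2 u2 x where 4:
      "C (p1 @ v2) (q1 @ u2)" "pos_word n x" "peq n z (v2 @ x)" "peq n y (u2 @ x)" by blast
    show ?thesis
      using 4 peq_trans[OF 1(3) peq_append[OF peq_refl 4(3)]] peq_trans[OF 2(3) peq_append[OF peq_refl 4(4)]]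
      by (intro exI[of _ "p1 @ v2"] exI[of _ "q1 @ u2"] exI[of _ x]) auto
  qed
qed

text \<open>Depth enough for all runs in \<open>cube\<close>, in unary so that simplification
  unfolds \<open>reversing\<close>.\<close>

abbreviation fuel :: nat where
  "fuel \<equiv> Suc (Suc (Suc (Suc (Suc 0))))"

text \<open>
  For \<open>a u = c t = b v\<close>, the tail \<open>t\<close> is a common multiple of the complements of \<open>a\<close> and \<open>b\<close> in \<open>c\<close>. The cube
  condition says that each such multiple makes \<open>u\<close> and \<open>v\<close> factor through the complements of \<open>a\<close> and \<open>b\<close>.
\<close>

definition cube :: "gen \<Rightarrow> gen \<Rightarrow> gen \<Rightarrow> bool" where
  "cube a c b \<longleftrightarrow> (case (compl a c, compl c a, compl b c, compl c b) of
     (Some ac, Some ca, Some bc, Some cb) \<Rightarrow>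
       reversing True fuel ca cb (\<lambda>p q.
         (case (compl a b, compl b a) of
            (Some ab, Some ba) \<Rightarrow> reversing False fuel (ac @ p) ab (\<lambda>v s. v = [] \<and>
               reversing False fuel (bc @ q) (ba @ s) (\<lambda>x y. x = [] \<and> y = []))
          | _ \<Rightarrow> False))
   | _ \<Rightarrow> True)"

lemma cube_holds: "cube a c b"
proof -
  have *: "cube a c b" if "a = Sg i \<or> a = Xg i" "c = Sg j \<or> c = Xg j" "b = Sg k \<or> b = Xg k" for i j k
  proof -
    \<comment> \<open>Once equality and adjacency of the indices are fixed, all complements are
      determined and the runs evaluate by simplification. Three pairwise adjacent indices are
      impossible.\<close>
    consider "i = j" "j = k" | "i = j" "j \<noteq> k" "adj j k" | "i = j" "j \<noteq> k" "\<not> adj j k"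
      | "i = k" "j \<noteq> k" "adj j k" | "i = k" "j \<noteq> k" "\<not> adj j k"
      | "j = k" "i \<noteq> k" "adj i k" | "j = k" "i \<noteq> k" "\<not> adj i k"
      | "i \<noteq> j" "j \<noteq> k" "i \<noteq> k" "adj i j" "adj j k" "\<not> adj i k" 
      | "i \<noteq> j" "j \<noteq> k" "i \<noteq> k" "adj i j" "\<not> adj j k" "adj i k" 
      | "i \<noteq> j" "j \<noteq> k" "i \<noteq> k" "adj i j" "\<not> adj j k" "\<not> adj i k" 
      | "i \<noteq> j" "j \<noteq> k" "i \<noteq> k" "\<not> adj i j" "adj j k" "adj i k" 
      | "i \<noteq> j" "j \<noteq> k" "i \<noteq> k" "\<not> adj i j" "adj j k" "\<not> adj i k" 
      | "i \<noteq> j" "j \<noteq> k" "i \<noteq> k" "\<not> adj i j" "\<not> adj j k" "adj i k" 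
      | "i \<noteq> j" "j \<noteq> k" "i \<noteq> k" "\<not> adj i j" "\<not> adj j k" "\<not> adj i k"
      using adj_no_triangle[of i j k] by blast
    then show ?thesis
      by cases (use that in \<open>elim disjE; simp add: cube_def adj_sym\<close>)+
  qed
  show ?thesis
    using * by (cases a; cases c; cases b) (auto simp: cube_def split: option.splits)
qed


text \<open>Turns the evaluated \<open>cube\<close> into a statement on elements: the run with
  \<open>True\<close> decomposes the given common multiple of \<open>ca\<close> and
  \<open>cb\<close>, and the two runs with \<open>False\<close> verify that \<open>ac p\<close> and
  \<open>bc q\<close> are multiples of \<open>ab\<close> and \<open>ba\<close> with one
  cofactor.\<close>

lemma cube_condition:
  assumes "compl a c = Some ac" "compl c a = Some ca" "compl b c = Some bc" "compl c b = Some cb"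
    and pos: "pos_word n [a]" "pos_word n [b]" "pos_word n [c]"
    and garside: "\<And>a u b v. length (a # u) < N \<Longrightarrow> pos_word n (a # u) \<Longrightarrow> peq n (a # u) (b # v) \<Longrightarrow>
      factors_through_lcm n a u b v"
    and w: "peq n (ca @ w1) (cb @ w2)" "pos_word n (ca @ w1)" "length (ca @ w1) < N"
  shows "factors_through_lcm n a (ac @ w1) b (bc @ w2)"
proof -
  have "\<exists>p q w. (case (compl a b, compl b a) of
            (Some ab, Some ba) \<Rightarrow> reversing False fuel (ac @ p) ab (\<lambda>v s. v = [] \<and>
               reversing False fuel (bc @ q) (ba @ s) (\<lambda>x y. x = [] \<and> y = []))
          | _ \<Rightarrow> False) \<and> pos_word n w \<and> peq n w1 (p @ w) \<and> peq n w2 (q @ w)"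
    using cube_holds[of a c b] assms(1-4)
    by (intro reversing_common_multiple[OF garside _ w]) (auto simp: cube_def)
  then obtain p q w ab ba where ab: "compl a b = Some ab" "compl b a = Some ba"
    and red: "reversing False fuel (ac @ p) ab (\<lambda>v s. v = [] \<and>
               reversing False fuel (bc @ q) (ba @ s) (\<lambda>x y. x = [] \<and> y = []))"
    and pq: "pos_word n w" "peq n w1 (p @ w)" "peq n w2 (q @ w)"
    by (cases "compl a b"; cases "compl b a") auto
  have "pos_word n w2"
    using w peq_pos_iff by fastforce
  then have pos': "pos_word n (ac @ p)" "pos_word n ab" "pos_word n (bc @ q)" "pos_word n ba"
    using assms(1-4) pos ab pq w(2) peq_pos_iff[OF pq(2)] peq_pos_iff[OF pq(3)] compl_pos by auto
  \<comment> \<open>The continuation forces the left completion to be empty, so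
    \<open>ac p = ab s\<close>; the same \<open>s\<close> enters the second run.\<close>
  from reversing_sound[OF red pos'(1,2)] obtain s where s: "pos_word n s" "peq n (ac @ p) (ab @ s)"
    and red2: "reversing False fuel (bc @ q) (ba @ s) (\<lambda>x y. x = [] \<and> y = [])"
    by auto
  have s2: "peq n (bc @ q) (ba @ s)"
    using reversing_sound[OF red2] pos' s by auto
  have "peq n (ac @ w1) (ab @ s @ w)"
    using peq_trans[OF peq_append[OF peq_refl pq(2)], of ac "ab @ s @ w"] peq_append[OF s(2) peq_refl[of n w]] by simp
  moreover have "peq n (bc @ w2) (ba @ s @ w)"
    using peq_trans[OF peq_append[OF peq_refl pq(3)], of bc "ba @ s @ w"] peq_append[OF s2 peq_refl[of n w]] by simp
  ultimately show ?thesis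
    unfolding factors_through_lcm_def using ab pq(1) s(1) pos_word_simps(5) by blast
qed

lemma factors_through_lcm_sym: "factors_through_lcm n a u b v \<Longrightarrow> factors_through_lcm n b v a u"
  unfolding factors_through_lcm_def by blast

lemma factors_through_lcm_same:
  "peq n u v \<Longrightarrow> pos_word n (a # u) \<Longrightarrow> factors_through_lcm n a u a v"
  unfolding factors_through_lcm_def
  using compl_self[of n a] pos_word_Cons[of n a u] peq_sym by fastforce

text \<open>Each defining relation reads \<open>a p = b q\<close> with \<open>p\<close>,
  \<open>q\<close> the complements of its first letters, so \<open>w\<close> is just the remaining
  word \<open>z\<close>.\<close>

lemma factors_through_lcm_rel:
  assumes "(l, r) \<in> pos_rel n" "l @ z = a # u" "r @ z = b # v" "pos_word n (a # u)"
  shows "factors_through_lcm n a u b v"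
proof -
  have "factors_through_lcm n a (p @ z) b (q @ z)"
    if "compl a b = Some p" "compl b a = Some q" "pos_word n z" for p q
    using that unfolding factors_through_lcm_def by blast
  note factors = this
  have "pos_word n z" using assms(2,4) by (metis pos_word_simps(5))
  show ?thesis using assms(1)
    by cases (use assms(2,3) factors \<open>pos_word n z\<close> in \<open>fastforce simp: adj_def\<close>)+
qed

theorem garside_property:
  assumes "peq n (a # u) (b # v)" "pos_word n (a # u)"
  shows "factors_through_lcm n a u b v"
proof -
  have "factors_through_lcm n a u b v"
    if "length (a # u) = N" "peq n (a # u) (b # v)" "pos_word n (a # u)" for N a u b v
    using that
  proof (induction N arbitrary: a u b v rule: less_induct)
    case (less N)
    \<comment> \<open>Inner induction along the derivation of the congruence at fixed length
      \<open>N\<close>. Only its case \<open>trans\<close> needs the outer hypothesis.\<close>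
    have "factors_through_lcm n a u b v"
      if "mon_cong (pos_rel n) w1 w2" "w1 = a # u" "w2 = b # v" "length w1 = N" "pos_word n w1" for w1 w2 a u b v
      using that
    proof (induction arbitrary: a u b v rule: mon_cong.induct)
      case (rel l r w0 z)
      show ?case
      proof (cases w0)
        case Nil
        show ?thesis using factors_through_lcm_rel[OF rel(1)] rel Nil by simp
      next
        \<comment> \<open>The relation acts behind the first letter, hence \<open>a = b\<close> and
          both complements are empty.\<close>
        case (Cons a' w')
        have "peq n (w' @ l @ z) (w' @ r @ z)"
          using rel(1) by (simp add: peq_def mon_cong.rel)
        then show ?thesis
          using rel Cons factors_through_lcm_same[of n u v a] by auto
      qed
    next
      case (refl w)
      then show ?case by (auto intro: factors_through_lcm_same)
    next
      case (sym x y)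
      have "peq n x y" using sym(1) by (simp add: peq_def)
      then have "length x = N" "pos_word n x"
        using sym.prems peq_length peq_pos_iff by metis+
      then show ?case using sym by (intro factors_through_lcm_sym[OF sym.IH]) auto
    next
      case (trans x y z)
      have xy: "peq n x y" and yz: "peq n y z" using trans(1,2) by (simp_all add: peq_def)
      have y: "length y = N" "pos_word n y"
        using trans.prems peq_length[OF xy] peq_pos_iff[OF xy] by auto
      then obtain c t where ct: "y = c # t" using trans.prems by (cases y) auto
      have z: "length z = N" "pos_word n z"
        using y peq_length[OF yz] peq_pos_iff[OF yz] by auto
      obtain ac ca w1 where 1: "compl a c = Some ac" "compl c a = Some ca" "pos_word n w1"
        "peq n u (ac @ w1)" "peq n t (ca @ w1)"
        using trans.IH(1)[of a u c t] trans.prems ct y unfolding factors_through_lcm_def by auto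
      obtain bc cb w2 where 2: "compl b c = Some bc" "compl c b = Some cb" "pos_word n w2"
        "peq n v (bc @ w2)" "peq n t (cb @ w2)"
        using trans.IH(2)[of c t b v] trans.prems ct y unfolding factors_through_lcm_def by auto
      have pos: "pos_word n [a]" "pos_word n [b]" "pos_word n [c]" "pos_word n t"
        using trans.prems ct y z pos_word_Cons by metis+
      \<comment> \<open>\<open>t\<close> is a common multiple of \<open>ca\<close> and
        \<open>cb\<close> shorter than \<open>N\<close>, so the outer hypothesis is available to the
        cube condition.\<close>
      have "length t < N" using ct y by simp
      then have "pos_word n (ca @ w1)" "length (ca @ w1) < N"
        using pos(4) peq_pos_iff[OF 1(5)] peq_length[OF 1(5)] by auto
      moreover have "peq n (ca @ w1) (cb @ w2)"
        using peq_trans[OF peq_sym[OF 1(5)] 2(5)] .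
      ultimately have "factors_through_lcm n a (ac @ w1) b (bc @ w2)"
        using less.IH cube_condition[OF 1(1,2) 2(1,2) pos(1-3), of N w1 w2] by blast
      then show ?case
        unfolding factors_through_lcm_def using peq_trans[OF 1(4)] peq_trans[OF 2(4)] by blast
    qed
    then show ?case using less.prems by (simp add: peq_def)
  qed
  then show ?thesis using assms by blast
qed

text \<open>For equal first letters both complements are empty, so \<open>u\<close> and
  \<open>v\<close> both equal the common \<open>w\<close>.\<close>

lemma peq_Cons_cancel:
  assumes "peq n (a # u) (a # v)" "pos_word n (a # u)"
  shows "peq n u v"
  using garside_property[OF assms] compl_self[of n a] assms(2) pos_word_Cons[of n a u]
  unfolding factors_through_lcm_def by (auto intro: peq_trans peq_sym)

lemma peq_append_cancel:
  "peq n (x @ u) (x @ v) \<Longrightarrow> pos_word n (x @ u) \<Longrightarrow> peq n u v"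
proof (induction x)
  case (Cons a x)
  have "pos_word n (x @ u)" using Cons.prems(2) pos_word_Cons[of n a "x @ u"] by simp
  then show ?case using Cons peq_Cons_cancel[of n a "x @ u" "x @ v"] by simp
qed simp

section \<open>Least common multiples of positive braids\<close>

lemma compl_braid:
  assumes "braid_word n [a]" "braid_word n [b]"
  shows "\<exists>p. compl a b = Some p \<and> braid_word n p"
  using assms by (cases a; cases b) auto

lemma braid_word_Cons: "braid_word n (a # u) \<longleftrightarrow> braid_word n [a] \<and> braid_word n u"
  by (auto simp: braid_word_def)

text \<open>The universal property ranges over all positive common multiples, also those containing
  letters x, and factors both cofactors through the same \<open>w\<close>, which allows such squares
  to be pasted.\<close>

definition is_braid_lcm :: "nat \<Rightarrow> gen list \<Rightarrow> gen list \<Rightarrow> gen list \<Rightarrow> gen list \<Rightarrow> bool" where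
  "is_braid_lcm n u v p q \<longleftrightarrow> braid_word n p \<and> braid_word n q \<and> peq n (u @ p) (v @ q) \<and>
     (\<forall>y1 y2. pos_word n (u @ y1) \<longrightarrow> peq n (u @ y1) (v @ y2) \<longrightarrow>
       (\<exists>w. pos_word n w \<and> peq n y1 (p @ w) \<and> peq n y2 (q @ w)))"

lemma is_braid_lcmD:
  assumes "is_braid_lcm n u v p q" "pos_word n (u @ y1)" "peq n (u @ y1) (v @ y2)"
  obtains w where "pos_word n w" "peq n y1 (p @ w)" "peq n y2 (q @ w)"
  using assms unfolding is_braid_lcm_def by blast

lemma is_braid_lcm_Nil: "braid_word n v \<Longrightarrow> is_braid_lcm n [] v v []"
  unfolding is_braid_lcm_def using peq_pos_iff by fastforce

lemma is_braid_lcm_sym: "is_braid_lcm n u v p q \<Longrightarrow> is_braid_lcm n v u q p"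
  unfolding is_braid_lcm_def using peq_pos_iff peq_sym by metis

text \<open>Pastes four squares into a two by two grid: the square of the letters \<open>a\<close>,
  \<open>b\<close>, the two squares next to it, and the square closing the far corner. The universal
  property is chased through them in this order.\<close>

lemma is_braid_lcm_Cons:
  assumes P: "compl a b = Some P" and Q: "compl b a = Some Q"
    and pos: "pos_word n [a]" "pos_word n [b]"
    and 1: "is_braid_lcm n u P p1 u1" and 2: "is_braid_lcm n v Q q1 v1"
    and 3: "is_braid_lcm n u1 v1 v2 u2"
  shows "is_braid_lcm n (a # u) (b # v) (p1 @ v2) (q1 @ u2)"
proof -
  have "peq n (a # u @ p1 @ v2) (a # P @ u1 @ v2)"
    using peq_Cons[OF peq_append[OF _ peq_refl[of n v2]], of "u @ p1" "P @ u1"] 1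
    by (simp add: is_braid_lcm_def)
  also have "peq n \<dots> (b # Q @ v1 @ u2)"
    using peq_append[OF compl_peq[OF P Q pos], of "u1 @ v2" "v1 @ u2"] 3
    by (simp add: is_braid_lcm_def)
  also have "peq n \<dots> (b # v @ q1 @ u2)"
    using peq_Cons[OF peq_append[OF peq_sym peq_refl[of n u2]], of "v @ q1" "Q @ v1"] 2
    by (simp add: is_braid_lcm_def)
  finally have eq: "peq n ((a # u) @ p1 @ v2) ((b # v) @ q1 @ u2)" by simp
  have "\<exists>w. pos_word n w \<and> peq n y1 ((p1 @ v2) @ w) \<and> peq n y2 ((q1 @ u2) @ w)"
    if y: "pos_word n ((a # u) @ y1)" "peq n ((a # u) @ y1) ((b # v) @ y2)" for y1 y2
  proof -
    have posv: "pos_word n (u @ y1)" "pos_word n (v @ y2)"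
      using y peq_pos_iff[OF y(2)] pos_word_Cons[of n a "u @ y1"] pos_word_Cons[of n b "v @ y2"] by auto
    have "factors_through_lcm n a (u @ y1) b (v @ y2)"
      using garside_property y by simp
    then obtain w where w: "pos_word n w" "peq n (u @ y1) (P @ w)" "peq n (v @ y2) (Q @ w)"
      using P Q unfolding factors_through_lcm_def by auto
    obtain z where z: "pos_word n z" "peq n y1 (p1 @ z)" "peq n w (u1 @ z)"
      using is_braid_lcmD[OF 1 posv(1) w(2)] .
    obtain y where y: "pos_word n y" "peq n y2 (q1 @ y)" "peq n w (v1 @ y)"
      using is_braid_lcmD[OF 2 posv(2) w(3)] .
    obtain x where x: "pos_word n x" "peq n z (v2 @ x)" "peq n y (u2 @ x)"
      using is_braid_lcmD[OF 3 _ peq_trans[OF peq_sym[OF z(3)] y(3)]] peq_pos_iff[OF z(3)] w(1) by blast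
    show ?thesis
      using x(1) peq_trans[OF z(2) peq_append[OF peq_refl x(2)]] peq_trans[OF y(2) peq_append[OF peq_refl x(3)]]
      by auto
  qed
  then show ?thesis
    using 1 2 3 eq unfolding is_braid_lcm_def by auto
qed

text \<open>Reversing braid words never clashes, but might fail to terminate. The given common
  multiple bounds it: each sub-square has a strictly shorter common multiple.\<close>

lemma braid_lcm_exists:
  assumes "braid_word n u" "braid_word n v" "peq n (u @ w1) (v @ w2)" "pos_word n (u @ w1)"
  shows "\<exists>p q. is_braid_lcm n u v p q"
  using assms
proof (induction "length (u @ w1)" arbitrary: u v w1 w2 rule: less_induct)
  case less
  consider "u = []" | "v = []" | a u' b v' where "u = a # u'" "v = b # v'"
    by (cases u; cases v) auto
  then show ?case
  proof cases
    case 1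
    then show ?thesis using is_braid_lcm_Nil less.prems by blast
  next
    case 2
    then show ?thesis using is_braid_lcm_Nil is_braid_lcm_sym less.prems by blast
  next
    case 3
    have br: "braid_word n [a]" "braid_word n u'" "braid_word n [b]" "braid_word n v'"
      using less.prems 3 braid_word_Cons by blast+
    obtain P Q where PQ: "compl a b = Some P" "braid_word n P" "compl b a = Some Q" "braid_word n Q"
      using compl_braid br by meson
    have "factors_through_lcm n a (u' @ w1) b (v' @ w2)"
      using garside_property less.prems 3 by simp
    then obtain w where w: "pos_word n w" "peq n (u' @ w1) (P @ w)" "peq n (v' @ w2) (Q @ w)"
      using PQ unfolding factors_through_lcm_def by auto
    have pos: "pos_word n (u' @ w1)" "pos_word n (v' @ w2)"
      using less.prems(3,4) 3 peq_pos_iff[OF less.prems(3)]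
        pos_word_Cons[of n a "u' @ w1"] pos_word_Cons[of n b "v' @ w2"] by auto
    have len: "length (u' @ w1) < length (u @ w1)" "length (v' @ w2) < length (u @ w1)"
      using 3 peq_length[OF less.prems(3)] by auto
    obtain p1 u1 where 1: "is_braid_lcm n u' P p1 u1"
      using less.hyps[OF len(1) br(2) PQ(2) w(2) pos(1)] by blast
    obtain q1 v1 where 2: "is_braid_lcm n v' Q q1 v1"
      using less.hyps[OF len(2) br(4) PQ(4) w(3) pos(2)] by blast
    obtain z where z: "pos_word n z" "peq n w (u1 @ z)"
      using is_braid_lcmD[OF 1 pos(1) w(2)] by blast
    obtain y where y: "pos_word n y" "peq n w (v1 @ y)"
      using is_braid_lcmD[OF 2 pos(2) w(3)] by blast
    \<comment> \<open>The corner square is bounded by \<open>w\<close>, of which both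
      \<open>u1\<close> and \<open>v1\<close> are left divisors.\<close>
    have "length (u1 @ z) < length (u @ w1)" "pos_word n (u1 @ z)"
      using w(1) len(1) peq_length[OF w(2)] peq_length[OF z(2)] peq_pos_iff[OF z(2)] by auto
    moreover have "braid_word n u1" "braid_word n v1"
      using 1 2 by (auto simp: is_braid_lcm_def)
    ultimately obtain v2 u2 where "is_braid_lcm n u1 v1 v2 u2"
      using less.hyps[OF _ _ _ peq_trans[OF peq_sym[OF z(2)] y(2)]] by blast
    then have "is_braid_lcm n (a # u') (b # v') (p1 @ v2) (q1 @ u2)"
      using is_braid_lcm_Cons PQ 1 2 braid_imp_pos br by blast
    then show ?thesis using 3 by blast
  qed
qed

section \<open>Divisibility and greatest braid divisors\<close>

lemma pdvd_peq: "peq n b b' \<Longrightarrow> pdvd n a b \<Longrightarrow> pdvd n a b'"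
  unfolding pdvd_def using peq_trans by blast

text \<open>A cofactor of a braid is a braid, as the congruence preserves braid words. Divisibility
  in the braid monoid is thus that of the whole positive monoid.\<close>

lemma bdvd_iff_pdvd: "braid_word n b \<Longrightarrow> bdvd n a b \<longleftrightarrow> pdvd n a b"
  unfolding bdvd_def pdvd_def
  using peq_braid_iff braid_imp_pos braid_word_simps(5) by blast

lemma pdvd_length: "pdvd n a b \<Longrightarrow> length a \<le> length b"
  unfolding pdvd_def using peq_length by fastforce

lemma pdvd_antisym:
  assumes "pdvd n a b" "length b \<le> length a"
  shows "peq n a b"
proof -
  obtain c where c: "peq n (a @ c) b" using assms(1) unfolding pdvd_def by blast
  then have "c = []" using assms(2) peq_length[OF c] by (cases c) auto
  then show ?thesis using c by simp
qed

lemma braid_join_exists: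
  assumes "braid_word n s" "braid_word n s'" "pdvd n s W" "pdvd n s' W" "pos_word n W"
  shows "\<exists>m. braid_word n m \<and> pdvd n s m \<and> pdvd n s' m \<and>
    (\<forall>V. pos_word n V \<longrightarrow> pdvd n s V \<longrightarrow> pdvd n s' V \<longrightarrow> pdvd n m V)"
proof -
  obtain c c' where c: "pos_word n c" "peq n (s @ c) W" "peq n (s' @ c') W"
    using assms unfolding pdvd_def by blast
  obtain p q where lcm: "is_braid_lcm n s s' p q"
    using braid_lcm_exists[OF assms(1,2) peq_trans[OF c(2) peq_sym[OF c(3)]]] c(1) assms(1) braid_imp_pos
    by auto
  have "pdvd n (s @ p) V" if V: "pos_word n V" "pdvd n s V" "pdvd n s' V" for V
  proof -
    obtain d d' where d: "pos_word n d" "peq n (s @ d) V" "peq n (s' @ d') V"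
      using V unfolding pdvd_def by blast
    have "pos_word n (s @ d)" using d assms(1) braid_imp_pos by simp
    then obtain w where w: "pos_word n w" "peq n d (p @ w)"
      using is_braid_lcmD[OF lcm _ peq_trans[OF d(2) peq_sym[OF d(3)]]] by blast
    then have "peq n ((s @ p) @ w) V"
      using peq_trans[OF peq_append[OF peq_refl peq_sym[OF w(2)]], of s V] d(2) by simp
    then show ?thesis using w(1) unfolding pdvd_def by blast
  qed
  moreover have "pdvd n s (s @ p)" "pdvd n s' (s @ p)" "braid_word n (s @ p)"
    using lcm assms braid_imp_pos peq_sym[of n "s @ p" "s' @ q"] unfolding is_braid_lcm_def pdvd_def by auto
  ultimately show ?thesis by blast
qed

text \<open>A longest common braid divisor is the greatest one: its join with any other still
  divides all of \<open>S\<close>, so is no longer and must equal it. A set \<open>S\<close> serves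
  both the greatest braid divisor of one element and the gcd with Delta.\<close>

lemma greatest_common_braid_ldiv_exists:
  assumes "\<forall>V\<in>S. pos_word n V" "S \<noteq> {}"
  shows "\<exists>s. braid_word n s \<and> (\<forall>V\<in>S. pdvd n s V) \<and>
    (\<forall>s'. braid_word n s' \<longrightarrow> (\<forall>V\<in>S. pdvd n s' V) \<longrightarrow> pdvd n s' s)"
proof -
  let ?P = "\<lambda>s. braid_word n s \<and> (\<forall>V\<in>S. pdvd n s V)"
  obtain W where W: "W \<in> S" using assms(2) by blast
  have "?P []" using assms(1) by (auto simp: pdvd_def)
  moreover have "\<forall>s. ?P s \<longrightarrow> length s < Suc (length W)"
    using pdvd_length W less_Suc_eq_le by blast
  ultimately obtain s where s: "?P s" and max: "\<forall>y. ?P y \<longrightarrow> length y \<le> length s"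
    using ex_has_greatest_nat[of ?P "[]" length "Suc (length W)"] by blast
  have "pdvd n s' s" if s': "?P s'" for s'
  proof -
    obtain m where m: "braid_word n m" "pdvd n s m" "pdvd n s' m"
      "\<forall>V. pos_word n V \<longrightarrow> pdvd n s V \<longrightarrow> pdvd n s' V \<longrightarrow> pdvd n m V"
      using braid_join_exists[of n s s' W] s s' W assms(1) by blast
    then have "?P m" using s s' assms(1) by blast
    then have "peq n s m" using max m(2) pdvd_antisym by blast
    then show ?thesis using m(3) pdvd_peq peq_sym by blast
  qed
  then show ?thesis using s by blast
qed

text \<open>The presentation is stable under reversal: \<open>ssx1\<close> and \<open>ssx2\<close>
  change places, every other relation is its own mirror image. Right-handed facts will follow from
  left-handed ones.\<close>

lemma pos_rel_rev: "(l, r) \<in> pos_rel n \<Longrightarrow> peq n (rev l) (rev r)"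
  by (cases rule: pos_rel.cases, assumption) (auto intro: peq_rel pos_rel.intros peq_sym
      peq_sym[OF peq_rel[OF pos_rel.ssx1[simplified]]] peq_sym[OF peq_rel[OF pos_rel.ssx2[simplified]]])

lemma peq_rev: "peq n u v \<Longrightarrow> peq n (rev u) (rev v)"
  unfolding peq_def
proof (induction rule: mon_cong.induct)
  case (rel l r u v)
  then show ?case
    using peq_append[OF peq_append[OF peq_refl pos_rel_rev[OF rel]] peq_refl, of "rev v" "rev u"]
    by (simp add: peq_def)
qed (blast intro: mon_cong.intros)+

lemma pos_word_rev [simp]: "pos_word n (rev u) \<longleftrightarrow> pos_word n u"
  by (simp add: pos_word_def)

lemma braid_word_rev [simp]: "braid_word n (rev u) \<longleftrightarrow> braid_word n u"
  by (simp add: braid_word_def)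

lemma peq_append_cancel_right:
  assumes "peq n (u @ x) (v @ x)" "pos_word n (u @ x)"
  shows "peq n u v"
  using peq_append_cancel[of n "rev x" "rev u" "rev v"] peq_rev[OF assms(1)] assms(2)
    peq_rev[of n "rev u" "rev v"] by simp

section \<open>The fundamental braid\<close>

abbreviation ascend :: "nat \<Rightarrow> gen list" where
  "ascend m \<equiv> map Sg [1..<Suc m]"

lemma delta_0 [simp]: "delta 0 = []" "delta (Suc 0) = []"
  by (simp_all add: delta_def)

lemma delta_Suc: "delta (Suc m) = ascend m @ delta m"
  by (cases m) (simp_all add: delta_def)

lemma peq_commute_word:
  "(\<And>h. h \<in> set u \<Longrightarrow> peq n [h, g] [g, h]) \<Longrightarrow> peq n (u @ [g]) (g # u)"
proof (induction u)
  case (Cons h u)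
  have "peq n (h # u @ [g]) (h # g # u)" using Cons by (intro peq_Cons) simp
  also have "peq n (h # g # u) (g # h # u)"
    using peq_append[OF Cons.prems[of h] peq_refl[of n u]] by simp
  finally show ?case by simp
qed simp

lemma peq_commute_words:
  assumes "\<And>h g. h \<in> set u \<Longrightarrow> g \<in> set v \<Longrightarrow> peq n [h, g] [g, h]"
  shows "peq n (u @ v) (v @ u)"
  using assms
proof (induction v)
  case (Cons g v)
  have "peq n ((u @ [g]) @ v) ((g # u) @ v)"
    using Cons.prems by (intro peq_append peq_commute_word) auto
  also have "peq n ((g # u) @ v) (g # v @ u)"
    using Cons by (auto intro: peq_Cons)
  finally show ?case by simp
qed simp

lemma Sg_commute:
  assumes "g = Sg \<or> g = Xg" "\<not> adj i j" "idx_ok n i" "idx_ok n j"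
  shows "peq n [Sg i, g j] [g j, Sg i]"
  using assms nonadj_commute(1)[of i j n] nonadj_commute(2)[of j i n, THEN peq_sym] by (auto simp: adj_sym)

lemma Sg_Sg_shift:
  assumes "g = Sg \<or> g = Xg" "adj i j" "idx_ok n i" "idx_ok n j"
  shows "peq n [Sg i, Sg j, g i] [g j, Sg i, Sg j]"
  using assms adj_braid_relations by auto

text \<open>Only the adjacent letters sigma with indices \<open>i\<close> and \<open>i + 1\<close>
  act on \<open>g i\<close>, raising its index; the others commute past it. A variable
  \<open>g\<close> treats sigma and x at once, since both obey the same relation with such a
  pair.\<close>

lemma ascend_shift:
  assumes "g = Sg \<or> g = Xg" "1 \<le> i" "i < m" "m < n"
  shows "peq n (ascend m @ [g i]) (g (Suc i) # ascend m)"
  using assms(2-)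
proof (induction m)
  case (Suc m)
  show ?case
  proof (cases "i = m")
    case True
    then obtain k where k: "m = Suc k" using Suc.prems by (cases m) auto
    have "peq n (ascend k @ [Sg m, Sg (Suc m), g m]) (ascend k @ [g (Suc m), Sg m, Sg (Suc m)])"
      using Suc.prems True assms(1) 
      by (intro peq_append peq_refl Sg_Sg_shift) (auto simp: adj_def idx_ok_def)
    also have "\<dots> = (ascend k @ [g (Suc m)]) @ [Sg m, Sg (Suc m)]" by simp
    also have "peq n \<dots> ((g (Suc m) # ascend k) @ [Sg m, Sg (Suc m)])"
      using k Suc.prems assms(1)
      by (intro peq_append peq_refl peq_commute_word) (auto intro!: Sg_commute simp: adj_def idx_ok_def)
    finally show ?thesis using True k by simp
  next
    case False
    have "peq n (ascend m @ [Sg (Suc m), g i]) (ascend m @ [g i, Sg (Suc m)])"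
      using Suc.prems False assms(1)
      by (intro peq_append peq_refl Sg_commute) (auto simp: adj_def idx_ok_def)
    also have "\<dots> = (ascend m @ [g i]) @ [Sg (Suc m)]" by simp
    also have "peq n \<dots> ((g (Suc i) # ascend m) @ [Sg (Suc m)])"
      using Suc False by (intro peq_append peq_refl) auto
    finally show ?thesis using Suc.prems by simp
  qed
qed simp

lemma descend_shift:
  assumes "g = Sg \<or> g = Xg" "1 \<le> i" "i < m" "m < n"
  shows "peq n (rev (ascend m) @ [g (Suc i)]) (g i # rev (ascend m))"
  using peq_rev[OF ascend_shift[OF assms]] by (auto intro: peq_sym)

lemma set_delta: "h \<in> set (delta m) \<Longrightarrow> \<exists>i. h = Sg i \<and> 1 \<le> i \<and> i < m"
  by (auto simp: delta_def)

text \<open>A second recursion for Delta, with the smaller Delta on the left. It handles the top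
  index, which \<open>delta_Suc\<close> does not reach.\<close>

lemma delta_descend:
  assumes "m < n"
  shows "peq n (delta (Suc m)) (delta m @ rev (ascend m))"
  using assms
proof (induction m)
  case (Suc k)
  have "peq n (ascend (Suc k) @ delta (Suc k)) (ascend (Suc k) @ delta k @ rev (ascend k))"
    using Suc by (intro peq_append peq_refl) auto
  also have "\<dots> = ascend k @ ([Sg (Suc k)] @ delta k) @ rev (ascend k)" by simp
  \<comment> \<open>The letters of \<open>delta k\<close> have indices below \<open>k\<close>, so
    all of them commute with \<open>Sg (Suc k)\<close>.\<close>
  also have "peq n \<dots> (ascend k @ (delta k @ [Sg (Suc k)]) @ rev (ascend k))"
    using Suc.prems
    by (intro peq_append peq_refl peq_commute_words)
       (auto dest!: set_delta intro!: nonadj_commute(1) simp: adj_def idx_ok_def)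
  finally show ?case by (simp add: delta_Suc)
qed simp

text \<open>Conjugation by Delta reflects indices. For \<open>i < k\<close> the smaller Delta
  reflects and the ascending run adds one. For \<open>i = k\<close> the descending run first lowers
  the index to \<open>k - 1\<close>, which the smaller Delta sends to 1.\<close>

lemma delta_shift:
  assumes "g = Sg \<or> g = Xg" "m \<le> n" "1 \<le> i" "i < m"
  shows "peq n (delta m @ [g i]) (g (m - i) # delta m)"
  using assms(2-)
proof (induction m arbitrary: i)
  case (Suc k)
  consider "i < k" | "i = k" "k = 1" | "i = k" "k \<ge> 2" using Suc.prems by linarith
  then show ?case
  proof cases
    case 1
    have "peq n (ascend k @ delta k @ [g i]) (ascend k @ g (k - i) # delta k)"
      using Suc 1 by (intro peq_append peq_refl) auto
    also have "\<dots> = (ascend k @ [g (k - i)]) @ delta k" by simp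
    also have "peq n \<dots> ((g (Suc (k - i)) # ascend k) @ delta k)"
      using Suc.prems 1 assms(1) by (intro peq_append peq_refl ascend_shift) auto
    finally show ?thesis using 1 by (simp add: delta_Suc Suc_diff_le)
  next
    case 2
    then have "peq n [Sg 1, g 1] [g 1, Sg 1]"
      using Suc.prems assms(1) by (intro Sg_commute) (auto simp: idx_ok_def)
    then show ?thesis using 2 by (simp add: delta_Suc)
  next
    case 3
    have "peq n (delta (Suc k) @ [g k]) (delta k @ rev (ascend k) @ [g k])"
      using peq_append[OF delta_descend peq_refl, of k n "[g k]"] Suc.prems by simp
    also have "peq n \<dots> (delta k @ g (k - 1) # rev (ascend k))"
      using 3 Suc.prems assms(1) descend_shift[of g "k - 1" k n] by (intro peq_append peq_refl) auto
    also have "\<dots> = (delta k @ [g (k - 1)]) @ rev (ascend k)" by simp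
    also have "peq n \<dots> ((g 1 # delta k) @ rev (ascend k))"
      using Suc.IH[of "k - 1"] 3 Suc.prems by (intro peq_append peq_refl) auto
    also have "peq n \<dots> (g 1 # delta (Suc k))"
      using peq_Cons[OF peq_sym[OF delta_descend[of k n]], of "g 1"] Suc.prems by (simp del: upt_Suc)
    finally show ?thesis using 3 by simp
  qed
qed simp

text \<open>Reversal exchanges the recursions \<open>delta_Suc\<close> and
  \<open>delta_descend\<close>.\<close>

lemma delta_rev:
  assumes "m \<le> n"
  shows "peq n (rev (delta m)) (delta m)"
  using assms
proof (induction m)
  case (Suc k)
  have "peq n (rev (delta k) @ rev (ascend k)) (delta k @ rev (ascend k))"
    using Suc by (intro peq_append peq_refl) auto
  also have "peq n \<dots> (delta (Suc k))"
    using Suc.prems by (intro peq_sym[OF delta_descend]) auto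
  finally show ?case by (simp add: delta_Suc)
qed simp

lemma braid_delta: "m \<le> n \<Longrightarrow> braid_word n (delta m)"
  using set_delta[of _ m] by (fastforce simp: braid_word_def idx_ok_def)

lemma braid_ascend: "m < n \<Longrightarrow> braid_word n (ascend m)"
  by (auto simp: braid_word_def idx_ok_def)

lemma delta_snoc: "\<exists>c. delta (Suc (Suc k)) = c @ [Sg 1]"
proof (induction k)
  case 0
  show ?case by (simp add: delta_Suc)
next
  case (Suc k)
  then show ?case by (metis delta_Suc append.assoc)
qed

text \<open>Lower indices are inherited from the smaller Delta, a left factor by
  \<open>delta_descend\<close>. For the top index write Delta as \<open>c\<close> followed by
  \<open>Sg 1\<close>; moving a further \<open>Sg 1\<close> through Delta and cancelling it leaves
  \<open>Sg k # c\<close>.\<close>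

lemma delta_ldiv:
  assumes "m \<le> n" "1 \<le> i" "i < m"
  shows "\<exists>d. braid_word n d \<and> peq n (Sg i # d) (delta m)"
  using assms
proof (induction m)
  case (Suc k)
  show ?case
  proof (cases "i = k")
    case True
    then obtain c where c: "delta (Suc k) = c @ [Sg 1]" 
      using delta_snoc[of "k - 1"] Suc.prems by (cases k) auto
    have "peq n (delta (Suc k) @ [Sg 1]) (Sg k # delta (Suc k))"
      using delta_shift[of Sg "Suc k" n 1] Suc.prems True by simp
    then have "peq n (delta (Suc k) @ [Sg 1]) ((Sg k # c) @ [Sg 1])"
      using c by simp
    then have "peq n (delta (Suc k)) (Sg k # c)"
      using braid_imp_pos[OF braid_delta[OF Suc.prems(1)]] Suc.prems
      by - (rule peq_append_cancel_right[where x = "[Sg 1]"], auto simp: idx_ok_def)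
    moreover have "braid_word n c"
      using braid_delta[OF Suc.prems(1)] c by simp
    ultimately show ?thesis using peq_sym True by blast
  next
    case False
    then obtain d where d: "braid_word n d" "peq n (Sg i # d) (delta k)"
      using Suc by auto
    have "peq n ((Sg i # d) @ rev (ascend k)) (delta k @ rev (ascend k))"
      using d by (intro peq_append peq_refl)
    also have "peq n \<dots> (delta (Suc k))"
      using Suc.prems by (intro peq_sym[OF delta_descend]) auto
    finally show ?thesis
      using d braid_ascend[of k n] Suc.prems by (intro exI[of _ "d @ rev (ascend k)"]) auto
  qed
qed simp

section \<open>Conjugation by Delta\<close>

fun flip_gen :: "nat \<Rightarrow> gen \<Rightarrow> gen" where
  "flip_gen n (Sg i) = Sg (n - i)"
| "flip_gen n (Sinv i) = Sinv (n - i)"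
| "flip_gen n (Xg i) = Xg (n - i)"

abbreviation flip :: "nat \<Rightarrow> gen list \<Rightarrow> gen list" where
  "flip n \<equiv> map (flip_gen n)"

lemma pos_flip: "pos_word n u \<Longrightarrow> pos_word n (flip n u)"
proof (induction u)
  case (Cons a u)
  then show ?case by (cases a) (auto simp: idx_ok_def)
qed simp

lemma flip_flip: "pos_word n u \<Longrightarrow> flip n (flip n u) = u"
proof (induction u)
  case (Cons a u)
  then show ?case by (cases a) (auto simp: idx_ok_def)
qed simp

lemma delta_flip:
  "pos_word n u \<Longrightarrow> peq n (delta n @ u) (flip n u @ delta n)"
proof (induction u)
  case (Cons a u)
  have pos: "pos_word n [a]" "pos_word n u" using Cons.prems pos_word_Cons by blast+
  have "peq n (delta n @ [a]) (flip_gen n a # delta n)"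
    using pos(1) delta_shift[of Sg n n] delta_shift[of Xg n n] by (cases a) (auto simp: idx_ok_def)
  then have "peq n ((delta n @ [a]) @ u) ((flip_gen n a # delta n) @ u)"
    by (intro peq_append peq_refl)
  also have "peq n ((flip_gen n a # delta n) @ u) (flip_gen n a # flip n u @ delta n)"
    using Cons.IH[OF pos(2)] peq_Cons by simp
  finally show ?case by simp
qed simp

lemma flip_delta:
  "pos_word n u \<Longrightarrow> peq n (u @ delta n) (delta n @ flip n u)"
  using delta_flip[OF pos_flip, of n u] flip_flip[of n u] peq_sym by simp

lemma pos_delta [simp]: "pos_word n (delta n)"
  by (simp add: braid_delta braid_imp_pos)

text \<open>No relation is inspected: conjugate by Delta and cancel it on the right.\<close>

lemma peq_flip:
  assumes "peq n u v" "pos_word n u"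
  shows "peq n (flip n u) (flip n v)"
proof -
  have v: "pos_word n v" using assms peq_pos_iff by blast
  have "peq n (flip n u @ delta n) (delta n @ u)"
    using delta_flip[OF assms(2)] peq_sym by blast
  also have "peq n \<dots> (delta n @ v)" using assms by (intro peq_append peq_refl)
  also have "peq n \<dots> (flip n v @ delta n)" using delta_flip[OF v] .
  finally show ?thesis using peq_append_cancel_right assms pos_flip by simp
qed

lemma flip_delta_self: "peq n (flip n (delta n)) (delta n)"
  using peq_append_cancel_right[of n "flip n (delta n)" "delta n" "delta n"] delta_flip[of n "delta n"] 
   peq_sym pos_flip by simp

lemma delta_rdiv:
  assumes "idx_ok n i"
  shows "\<exists>e. braid_word n e \<and> peq n (e @ [Sg i]) (delta n)"
proof -
  obtain d where d: "braid_word n d" "peq n (Sg i # d) (delta n)"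
    using delta_ldiv[of n n i] assms by (auto simp: idx_ok_def)
  have "peq n (rev d @ [Sg i]) (delta n)"
    using peq_trans[OF peq_rev[OF d(2)] delta_rev[of n n]] by simp
  then show ?thesis using d(1) by (intro exI[of _ "rev d"]) simp
qed

section \<open>Embedding of the positive monoid into the monoid of fractions\<close>

lemma sb_word_simps [simp]:
  "sb_word n []"
  "sb_word n (a # u) \<longleftrightarrow> letter_ok n a \<and> sb_word n u"
  "sb_word n (u @ v) \<longleftrightarrow> sb_word n u \<and> sb_word n v"
  "sb_word n (rev u) \<longleftrightarrow> sb_word n u"
  by (auto simp: sb_word_def)

lemma pos_imp_sb: "pos_word n u \<Longrightarrow> sb_word n u"
  by (auto simp: pos_word_def sb_word_def)

abbreviation wpower :: "gen list \<Rightarrow> nat \<Rightarrow> gen list" where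
  "wpower u k \<equiv> concat (replicate k u)"

lemma wpower_add: "wpower u (k + l) = wpower u k @ wpower u l"
  by (simp add: replicate_add)

lemma wpower_commute: "wpower u k @ wpower u l = wpower u l @ wpower u k"
  by (metis wpower_add add.commute)

lemma wpower_Suc_right: "wpower u (Suc k) = wpower u k @ u"
  using wpower_add[where k = k and l = 1 and u = u] by simp

lemma pos_wpower: "pos_word n u \<Longrightarrow> pos_word n (wpower u k)"
  by (induction k) auto

lemma peq_flip_delta_power: "peq n (flip n (wpower (delta n) k)) (wpower (delta n) k)"
proof (induction k)
  case (Suc k)
  then show ?case using peq_append[OF flip_delta_self Suc] by simp
qed simp

text \<open>The inverse of \<open>Sg i\<close> is this braid times the inverse of Delta. The choice
  is immaterial, being unique up to \<open>peq\<close>.\<close>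

definition cofactor :: "nat \<Rightarrow> nat \<Rightarrow> gen list" where
  "cofactor n i = (SOME d. braid_word n d \<and> peq n (Sg i # d) (delta n))"

lemma cofactor:
  assumes "idx_ok n i"
  shows "braid_word n (cofactor n i)" "peq n (Sg i # cofactor n i) (delta n)"
  using someI_ex[OF delta_ldiv[of n n i]] assms by (auto simp: cofactor_def idx_ok_def)

text \<open>Delta sends \<open>Sg (n - i)\<close> to \<open>Sg i\<close> in front, where it cancels.
  This is what the relation starting with \<open>Sinv i\<close> requires.\<close>

lemma cofactor_right:
  assumes "idx_ok n i"
  shows "peq n (cofactor n i @ [Sg (n - i)]) (delta n)"
proof -
  have ok: "idx_ok n (n - i)" using assms by (auto simp: idx_ok_def)
  note c = cofactor[OF assms]
  have "peq n (Sg i # cofactor n i @ [Sg (n - i)]) (delta n @ [Sg (n - i)])"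
    using peq_append[OF c(2) peq_refl, of "[Sg (n - i)]"] by simp
  also have "peq n \<dots> (Sg i # delta n)"
    using delta_flip[of n "[Sg (n - i)]"] ok assms by (simp add: idx_ok_def)
  finally show ?thesis
    using peq_Cons_cancel c(1) ok assms by (simp add: braid_imp_pos)
qed

text \<open>A word is represented as the fraction \<open>numer n w\<close> over the power \<open>denom_exp w\<close> of \<open>\<Delta>\<close>, written on the right; moving
  the inverse of \<open>\<Delta>\<close> past a word flips the indices.\<close>

fun numer :: "nat \<Rightarrow> gen list \<Rightarrow> gen list" where
  "numer n [] = []"
| "numer n (Sg i # w) = Sg i # numer n w"
| "numer n (Xg i # w) = Xg i # numer n w"
| "numer n (Sinv i # w) = cofactor n i @ flip n (numer n w)"

fun denom_exp :: "gen list \<Rightarrow> nat" where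
  "denom_exp [] = 0"
| "denom_exp (Sg i # w) = denom_exp w"
| "denom_exp (Xg i # w) = denom_exp w"
| "denom_exp (Sinv i # w) = Suc (denom_exp w)"

text \<open>Cross-multiplication of fractions; the denominators are powers of one element, hence
  commute with each other.\<close>

definition frac_eq :: "nat \<Rightarrow> gen list \<Rightarrow> gen list \<Rightarrow> bool" where
  "frac_eq n u v \<longleftrightarrow> peq n (numer n u @ wpower (delta n) (denom_exp v)) (numer n v @ wpower (delta n) (denom_exp u))"

lemma pos_numer: "sb_word n u \<Longrightarrow> pos_word n (numer n u)"
  by (induction u rule: denom_exp.induct) (auto intro: pos_flip braid_imp_pos cofactor)

lemma numer_pos: "pos_word n u \<Longrightarrow> numer n (u @ w) = u @ numer n w"
  by (induction u rule: denom_exp.induct) auto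

lemma denom_exp_pos: "pos_word n u \<Longrightarrow> denom_exp (u @ w) = denom_exp w"
  by (induction u rule: denom_exp.induct) auto

lemma frac_eq_trans:
  assumes "frac_eq n u v" "frac_eq n v w" "sb_word n u"
  shows "frac_eq n u w"
proof -
  let ?D = "\<lambda>u. wpower (delta n) (denom_exp u)"
  have "peq n ((numer n u @ ?D v) @ ?D w) ((numer n v @ ?D u) @ ?D w)"
    using assms(1) unfolding frac_eq_def by (rule peq_append_right)
  also have "(numer n v @ ?D u) @ ?D w = (numer n v @ ?D w) @ ?D u"
    using wpower_commute by simp
  also have "peq n \<dots> ((numer n w @ ?D v) @ ?D u)"
    using assms(2) unfolding frac_eq_def by (rule peq_append_right)
  finally have "peq n ((numer n u @ ?D w) @ ?D v) ((numer n w @ ?D u) @ ?D v)"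
    using wpower_commute[of "denom_exp v"] by simp
  then show ?thesis
    unfolding frac_eq_def using assms(3) pos_numer pos_wpower pos_delta
    by - (rule peq_append_cancel_right[of n _ "?D v"], auto)
qed

text \<open>The delicate letter is \<open>Sinv i\<close>: it flips both numerators and adds one
  Delta on each side. Flipping fixes powers of Delta up to \<open>peq\<close>, so the equation
  survives.\<close>

lemma frac_eq_Cons:
  assumes "frac_eq n u v" "letter_ok n a" "sb_word n u"
  shows "frac_eq n (a # u) (a # v)"
proof (cases a)
  case (Sinv i)
  have "peq n (flip n (numer n u) @ flip n (wpower (delta n) (denom_exp v)))
     (flip n (numer n v) @ flip n (wpower (delta n) (denom_exp u)))"
    using peq_flip[OF assms(1)[unfolded frac_eq_def]] assms(3) pos_numer pos_wpower pos_delta by simp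
  then have "peq n (flip n (numer n u) @ wpower (delta n) (denom_exp v))
     (flip n (numer n v) @ wpower (delta n) (denom_exp u))"
    by (meson peq_append peq_flip_delta_power peq_refl peq_sym peq_trans)
  then have "peq n (cofactor n i @ (flip n (numer n u) @ wpower (delta n) (denom_exp v)) @ delta n)
     (cofactor n i @ (flip n (numer n v) @ wpower (delta n) (denom_exp u)) @ delta n)"
    by (intro peq_append_left peq_append_right)
  then show ?thesis
    using Sinv by (simp add: frac_eq_def wpower_Suc_right del: replicate_Suc)
qed (use assms in \<open>auto simp: frac_eq_def intro: peq_Cons\<close>)

lemma frac_eq_prefix:
  "frac_eq n u v \<Longrightarrow> sb_word n x \<Longrightarrow> sb_word n u \<Longrightarrow> frac_eq n (x @ u) (x @ v)"
  by (induction x) (auto intro: frac_eq_Cons)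

lemma frac_eq_pos_rel:
  assumes "(l, r) \<in> pos_rel n"
  shows "frac_eq n (l @ v) (r @ v)"
proof -
  have "pos_word n l" "pos_word n r"
    using assms by (auto elim!: pos_rel.cases)
  then show ?thesis
    unfolding frac_eq_def using peq_append[OF peq_append[OF peq_rel[OF assms] peq_refl] peq_refl]
    by (simp add: numer_pos denom_exp_pos)
qed

text \<open>The numerator acquires a factor Delta before the flipped numerator of \<open>v\<close>;
  moving it to the end undoes the flip and balances the extra denominator.\<close>

lemma frac_eq_inv_rel:
  assumes "(l, r) \<in> inv_rel n" "sb_word n v"
  shows "frac_eq n (l @ v) (r @ v)"
  using assms(1)
proof cases
  case (1 i)
  have "peq n ((Sg i # cofactor n i) @ flip n (numer n v)) (delta n @ flip n (numer n v))"
    using cofactor[OF 1(3)] by (intro peq_append peq_refl)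
  also have "peq n \<dots> (numer n v @ delta n)"
    using flip_delta[OF pos_numer[OF assms(2)]] peq_sym by blast
  finally have "peq n (((Sg i # cofactor n i) @ flip n (numer n v)) @ wpower (delta n) (denom_exp v))
     ((numer n v @ delta n) @ wpower (delta n) (denom_exp v))"
    by (rule peq_append_right)
  then show ?thesis using 1 by (simp add: frac_eq_def)
next
  case (2 i)
  have "peq n ((cofactor n i @ [Sg (n - i)]) @ flip n (numer n v)) (delta n @ flip n (numer n v))"
    using cofactor_right[OF 2(3)] by (intro peq_append peq_refl)
  also have "peq n \<dots> (numer n v @ delta n)"
    using flip_delta[OF pos_numer[OF assms(2)]] peq_sym by blast
  finally have "peq n (((cofactor n i @ [Sg (n - i)]) @ flip n (numer n v)) @ wpower (delta n) (denom_exp v))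
     ((numer n v @ delta n) @ wpower (delta n) (denom_exp v))"
    by (rule peq_append_right)
  then show ?thesis using 2 by (simp add: frac_eq_def)
qed

text \<open>Well-formedness travels along the chain because \<open>frac_eq_trans\<close> cancels a
  power of Delta, which needs positive numerators.\<close>

lemma geq_frac_eq:
  assumes "geq n u v"
  shows "(sb_word n u \<longleftrightarrow> sb_word n v) \<and> (sb_word n u \<longrightarrow> frac_eq n u v)"
  using assms unfolding geq_def
proof (induction rule: mon_cong.induct)
  case (rel l r x y)
  have ok: "sb_word n l" "sb_word n r"
    using rel by (auto elim!: pos_rel.cases inv_rel.cases)
  have "frac_eq n (l @ y) (r @ y)" if "sb_word n y"
    using rel that frac_eq_pos_rel frac_eq_inv_rel by blast
  then show ?case using ok by (auto intro: frac_eq_prefix)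
next
  case (sym u v)
  then show ?case by (auto simp: frac_eq_def intro: peq_sym)
next
  case (trans u v w)
  then show ?case using frac_eq_trans by blast
qed (auto simp: frac_eq_def)

text \<open>A positive word is its own numerator with denominator exponent 0, so equality of
  fractions is \<open>peq\<close>.\<close>

theorem geq_imp_peq:
  assumes "geq n u v" "pos_word n u" "pos_word n v"
  shows "peq n u v"
  using geq_frac_eq[OF assms(1)] assms(2,3) pos_imp_sb[OF assms(2)]
    numer_pos[of n u "[]"] numer_pos[of n v "[]"] denom_exp_pos[of n u "[]"] denom_exp_pos[of n v "[]"]
  by (simp add: frac_eq_def)

section \<open>Calculus of \<open>geq\<close> and integral powers of Delta\<close>

lemma geq_refl [simp, intro]: "geq n u u"
  by (simp add: geq_def mon_cong.refl)

lemma geq_sym: "geq n u v \<Longrightarrow> geq n v u"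
  by (simp add: geq_def mon_cong.sym)

lemma geq_trans [trans]: "geq n u v \<Longrightarrow> geq n v w \<Longrightarrow> geq n u w"
  unfolding geq_def by (rule mon_cong.trans)

lemma geq_eq_trans [trans]:
  "u = v \<Longrightarrow> geq n v w \<Longrightarrow> geq n u w" "geq n u v \<Longrightarrow> v = w \<Longrightarrow> geq n u w"
  by simp_all

lemma geq_append: "geq n u u' \<Longrightarrow> geq n v v' \<Longrightarrow> geq n (u @ v) (u' @ v')"
  by (simp add: geq_def mon_cong_append)

lemma geq_append_left: "geq n u v \<Longrightarrow> geq n (x @ u) (x @ v)"
  by (simp add: geq_append)

lemma geq_append_right: "geq n u v \<Longrightarrow> geq n (u @ x) (v @ x)"
  by (simp add: geq_append)

lemma geq_rel: "(l, r) \<in> pos_rel n \<union> inv_rel n \<Longrightarrow> geq n l r"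
  using mon_cong.rel[of l r "pos_rel n \<union> inv_rel n" "[]" "[]"] by (simp add: geq_def)

lemma peq_imp_geq: "peq n u v \<Longrightarrow> geq n u v"
  unfolding peq_def geq_def
  by (induction rule: mon_cong.induct) (blast intro: mon_cong.intros)+

lemma geq_rev: "geq n u v \<Longrightarrow> geq n (rev u) (rev v)"
  unfolding geq_def
proof (induction rule: mon_cong.induct)
  case (rel l r u v)
  have "geq n (rev l) (rev r)"
    using rel
  proof
    assume "(l, r) \<in> pos_rel n"
    then show ?thesis using pos_rel_rev peq_imp_geq by blast
  next
    assume "(l, r) \<in> inv_rel n"
    then show ?thesis by cases (auto intro!: geq_rel inv_rel.intros)
  qed
  then show ?case
    using geq_append[OF geq_append[OF geq_refl, of n "rev l" "rev r" "rev v"] geq_refl, of "rev u"]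
    by (simp add: geq_def)
qed (blast intro: mon_cong.intros)+

lemma geq_inverse_word:
  assumes "braid_word n u"
  shows "geq n (u @ rev (map ginv u)) []" "geq n (rev (map ginv u) @ u) []"
proof -
  have "geq n (u @ rev (map ginv u)) [] \<and> geq n (rev (map ginv u) @ u) []"
    using assms
  proof (induction u)
    case (Cons a u)
    then obtain i where i: "a = Sg i" "idx_ok n i" by (auto simp: braid_word_def)
    have u: "geq n (u @ rev (map ginv u)) []" "geq n (rev (map ginv u) @ u) []"
      using Cons i by auto
    have inv: "geq n [Sg i, Sinv i] []" "geq n [Sinv i, Sg i] []"
      using i by (auto intro!: geq_rel inv_rel.intros)
    have "geq n ([Sg i] @ (u @ rev (map ginv u)) @ [Sinv i]) ([Sg i] @ [] @ [Sinv i])"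
      using u by (intro geq_append geq_refl)
    moreover have "geq n (rev (map ginv u) @ [Sinv i, Sg i] @ u) (rev (map ginv u) @ [] @ u)"
      using inv by (intro geq_append geq_refl)
    ultimately show ?case
      using i u inv by (auto intro: geq_trans)
  qed simp
  then show "geq n (u @ rev (map ginv u)) []" "geq n (rev (map ginv u) @ u) []" by auto
qed

lemma geq_wpower_inverse:
  assumes "geq n (u @ v) []"
  shows "geq n (wpower u k @ wpower v k) []"
proof (induction k)
  case (Suc k)
  have "geq n (wpower u k @ (u @ v) @ wpower v k) (wpower u k @ [] @ wpower v k)"
    using assms by (intro geq_append geq_refl)
  moreover have "wpower u (Suc k) @ wpower v (Suc k) = wpower u k @ (u @ v) @ wpower v k"
    by (subst wpower_Suc_right) simp
  ultimately show ?case using Suc geq_trans by (metis append_Nil)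
qed simp

lemma geq_wpower_Suc_inverse:
  assumes "geq n (u @ v) []"
  shows "geq n (wpower u (Suc k) @ v) (wpower u k)"
  using geq_append[OF geq_refl assms, of "wpower u k"]
  by (simp add: wpower_Suc_right del: replicate_Suc)

lemma delta_pow_of_nat: "delta_pow n (int k) = wpower (delta n) k"
  by (simp add: delta_pow_def)

lemma delta_pow_inverse: "geq n (delta_pow n (- t) @ delta_pow n t) []"
  unfolding delta_pow_def
  using geq_wpower_inverse[OF geq_inverse_word(1)[OF braid_delta[of n n]]]
    geq_wpower_inverse[OF geq_inverse_word(2)[OF braid_delta[of n n]]]
  by (cases "t = 0") auto

lemma delta_pow_add1: "geq n (delta_pow n t @ delta n) (delta_pow n (t + 1))"
proof (cases "t \<ge> 0")
  case True
  then have "nat (t + 1) = Suc (nat t)" by simp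
  then show ?thesis using True by (simp add: delta_pow_def wpower_Suc_right del: replicate_Suc)
next
  case False
  then have "nat (- t) = Suc (nat (- (t + 1)))" by simp
  then show ?thesis
    using False geq_wpower_Suc_inverse[OF geq_inverse_word(2)[OF braid_delta[of n n]], of "nat (- (t + 1))"]
    \<comment> \<open>At \<open>t = -1\<close> the power \<open>t + 1\<close> already falls under
      the non-negative branch of \<open>delta_pow\<close>.\<close>
    by (cases "t = -1") (simp_all add: delta_pow_def del: replicate_Suc)
qed

lemma delta_pow_cancel:
  assumes "geq n (delta_pow n t @ u) (delta_pow n t @ v)"
  shows "geq n u v"
proof -
  have *: "geq n ((delta_pow n (- t) @ delta_pow n t) @ x) ([] @ x)" for x
    using delta_pow_inverse by (intro geq_append geq_refl)
  have "geq n (delta_pow n (- t) @ delta_pow n t @ u) (delta_pow n (- t) @ delta_pow n t @ v)"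
    using assms by (rule geq_append_left)
  then show ?thesis
    using *[of u] *[of v] geq_trans geq_sym by (metis append.assoc append_Nil)
qed

text \<open>Each trailing \<open>Sinv i\<close> costs one more Delta on the left. Delta moves
  through the positive part, flipping it, and then ends in \<open>Sg i\<close>, which cancels the
  inverse letter.\<close>

lemma clear_denominators:
  assumes "sb_word n w"
  shows "\<exists>k v. pos_word n v \<and> geq n (wpower (delta n) k @ w) v"
  using assms
proof (induction w rule: rev_induct)
  case Nil
  show ?case by (rule exI[of _ 0], rule exI[of _ "[]"]) simp
next
  case (snoc g w)
  then obtain k v where v: "pos_word n v" "geq n (wpower (delta n) k @ w) v" by auto
  then have vg: "geq n (wpower (delta n) k @ w @ [g]) (v @ [g])"
    using geq_append[OF v(2) geq_refl, of "[g]"] by simp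
  show ?case
  proof (cases "\<exists>i. g = Sinv i")
    case False
    then have "pos_word n (v @ [g])" using v snoc.prems by (cases g) auto
    then show ?thesis using vg by blast
  next
    case True
    then obtain i where i: "g = Sinv i" "idx_ok n i" using snoc.prems by auto
    obtain e where e: "braid_word n e" "peq n (e @ [Sg i]) (delta n)"
      using delta_rdiv[OF i(2)] by blast
    have "geq n (delta n @ wpower (delta n) k @ w @ [g]) (delta n @ v @ [g])"
      using vg by (rule geq_append_left)
    also have "\<dots> = (delta n @ v) @ [g]" by simp
    also have "geq n \<dots> ((flip n v @ e @ [Sg i]) @ [g])"
      using peq_trans[OF delta_flip[OF v(1)] peq_append_left[OF peq_sym[OF e(2)]]]
      by (intro geq_append_right peq_imp_geq)
    also have "\<dots> = (flip n v @ e) @ [Sg i, Sinv i]" using i by simp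
    also have "geq n \<dots> ((flip n v @ e) @ [])"
      using i by (intro geq_append_left geq_rel) (auto intro: inv_rel.intros)
    finally have "geq n (wpower (delta n) (Suc k) @ w @ [g]) (flip n v @ e)" by simp
    then show ?thesis using v(1) e(1) pos_flip braid_imp_pos
      by (intro exI[of _ "Suc k"] exI[of _ "flip n v @ e"]) simp
  qed
qed

section \<open>The sigma degree and the maximal exponent of Delta\<close>

fun degree :: "gen list \<Rightarrow> int" where
  "degree [] = 0"
| "degree (Sg i # w) = degree w + 1"
| "degree (Xg i # w) = degree w"
| "degree (Sinv i # w) = degree w - 1"

lemma degree_append [simp]: "degree (u @ v) = degree u + degree v"
  by (induction u rule: degree.induct) auto

lemma degree_rev [simp]: "degree (rev u) = degree u"
proof (induction u)
  case (Cons a u)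
  then show ?case by (cases a) auto
qed simp

lemma degree_ginv: "degree (map ginv u) = - degree u"
  by (induction u rule: degree.induct) auto

lemma geq_degree: "geq n u v \<Longrightarrow> degree u = degree v"
  unfolding geq_def
  by (induction rule: mon_cong.induct) (auto elim!: pos_rel.cases inv_rel.cases)

lemma degree_wpower: "degree (wpower u k) = int k * degree u"
  by (induction k) (auto simp: algebra_simps)

lemma degree_delta_pow: "degree (delta_pow n t) = t * degree (delta n)"
  by (simp add: delta_pow_def degree_wpower degree_ginv)

lemma degree_pos: "pos_word n u \<Longrightarrow> degree u \<ge> 0"
  by (induction u rule: degree.induct) auto

lemma degree_braid: "braid_word n u \<Longrightarrow> degree u = int (length u)"
  by (induction u rule: degree.induct) auto

text \<open>For \<open>n = 1\<close> Delta is the empty word and no exponent could be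
  maximal.\<close>

lemma degree_delta_ge_1:
  assumes "n \<ge> 2"
  shows "degree (delta n) \<ge> 1"
proof -
  obtain k where "n = Suc (Suc k)" using assms by (metis add_2_eq_Suc le_Suc_ex)
  then have "delta n \<noteq> []" using delta_snoc[of k] by auto
  then show ?thesis using degree_braid[OF braid_delta[of n n]] by (cases "delta n") auto
qed

lemma delta_exponent_bound:
  assumes "n \<ge> 2" "pos_word n v" "geq n w (delta_pow n s @ v)"
  shows "s \<le> \<bar>degree w\<bar>"
proof -
  have "degree w = s * degree (delta n) + degree v"
    using geq_degree[OF assms(3)] by (simp add: degree_delta_pow)
  then have "s * degree (delta n) \<le> \<bar>degree w\<bar>"
    using degree_pos[OF assms(2)] by simp
  moreover have "s \<le> s * degree (delta n)" if "s \<ge> 0"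
    using mult_left_mono[OF degree_delta_ge_1[OF assms(1)] that] by simp
  ultimately show ?thesis by linarith
qed

lemma delta_normal_form_exists:
  assumes "n \<ge> 2" "sb_word n w"
  shows "\<exists>t v. pos_word n v \<and> geq n w (delta_pow n t @ v) \<and>
    (\<forall>s v. pos_word n v \<longrightarrow> geq n w (delta_pow n s @ v) \<longrightarrow> s \<le> t)"
proof -
  obtain k v where kv: "pos_word n v" "geq n (wpower (delta n) k @ w) v"
    using clear_denominators[OF assms(2)] by blast
  let ?b = "- int k"
  have "geq n (delta_pow n ?b @ delta_pow n (int k) @ w) (delta_pow n ?b @ v)"
    using kv(2) by (intro geq_append_left) (simp add: delta_pow_of_nat)
  moreover have "geq n ((delta_pow n ?b @ delta_pow n (int k)) @ w) ([] @ w)"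
    using delta_pow_inverse by (intro geq_append geq_refl)
  ultimately have b: "geq n w (delta_pow n ?b @ v)"
    using geq_trans geq_sym by (metis append.assoc append_Nil)
  \<comment> \<open>Exponents are counted from the attained value \<open>?b\<close>, which reduces
    the maximum to one over natural numbers.\<close>
  let ?P = "\<lambda>j. \<exists>v. pos_word n v \<and> geq n w (delta_pow n (?b + int j) @ v)"
  have "?P 0" using kv(1) b by auto
  moreover have "\<forall>j. ?P j \<longrightarrow> j \<le> nat (\<bar>degree w\<bar> + int k)"
    using delta_exponent_bound[OF assms(1)] by fastforce
  ultimately obtain j where j: "?P j" "\<And>i. ?P i \<Longrightarrow> i \<le> j"
    using Nat.ex_has_greatest_nat[of ?P 0 "nat (\<bar>degree w\<bar> + int k)"] by blast
  have "s \<le> ?b + int j" if "pos_word n v" "geq n w (delta_pow n s @ v)" for s v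
  proof (rule ccontr)
    assume "\<not> s \<le> ?b + int j"
    then obtain i where "s = ?b + int i" "i > j"
      by (intro that[of "nat (s + int k)"]) auto
    then show False using j(2)[of i] that by auto
  qed
  then show ?thesis using j(1) by blast
qed

section \<open>Left-greedy forms\<close>

lemma pcls_cong: "peq n u v \<Longrightarrow> pcls n u = pcls n v"
  unfolding pcls_def using peq_trans peq_sym by blast

lemma fword_frag:
  assumes "pos_word n a"
  shows "peq n (fword (Frag (pcls n a))) a"
proof -
  have "a \<in> pcls n a" using assms by (simp add: pcls_def)
  then have "(SOME w. w \<in> pcls n a) \<in> pcls n a" by (rule someI)
  then show ?thesis by (auto simp: fword_def pcls_def intro: peq_sym)
qed

lemma is_frag_braid: "is_frag n f \<Longrightarrow> braid_word n (fword f)"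
  unfolding is_frag_def using fword_frag braid_imp_pos peq_braid_iff by blast

text \<open>Fragments are stored as congruence classes, so uniqueness up to \<open>peq\<close>
  becomes literal equality of factors.\<close>

lemma is_frag_eqI:
  assumes "is_frag n f" "is_frag n g" "peq n (fword f) (fword g)"
  shows "f = g"
proof -
  obtain a b where ab: "braid_word n a" "f = Frag (pcls n a)" "braid_word n b" "g = Frag (pcls n b)"
    using assms unfolding is_frag_def by blast
  then have "peq n a b"
    using assms(3) fword_frag braid_imp_pos peq_trans peq_sym by metis
  then show ?thesis using ab pcls_cong by simp
qed

lemma fprod_simps [simp]:
  "fprod [] = []" "fprod (f # fs) = fword f @ fprod fs" "fprod (fs @ gs) = fprod fs @ fprod gs"
  by (simp_all add: fprod_def)

lemma fword_Xf [simp]: "fword (Xf i) = [Xg i]"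
  by (simp add: fword_def)

lemma peq_Nil_iff: "peq n u [] \<longleftrightarrow> u = []"
  using peq_length by fastforce

text \<open>The maximality clause of \<open>left_greedy_braid\<close> in isolation. As that clause
  looks only at a suffix of the list, greediness becomes a recursion on lists.\<close>

definition delta_gcd :: "nat \<Rightarrow> gen list \<Rightarrow> gen list \<Rightarrow> bool" where
  "delta_gcd n a P \<longleftrightarrow> bdvd n a (delta n) \<and> bdvd n a P \<and>
     (\<forall>b. braid_word n b \<longrightarrow> bdvd n b (delta n) \<longrightarrow> bdvd n b P \<longrightarrow> bdvd n b a)"

lemma left_greedy_braid_Nil [simp]: "left_greedy_braid n []"
  by (simp add: left_greedy_braid_def)

lemma left_greedy_braid_Cons:
  "left_greedy_braid n (f # As) \<longleftrightarrow>
     is_frag n f \<and> fword f \<noteq> [] \<and> delta_gcd n (fword f) (fprod (f # As)) \<and> left_greedy_braid n As"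
  unfolding left_greedy_braid_def delta_gcd_def
  by (auto simp: All_less_Suc2 peq_Nil_iff)

lemma left_greedy_braid_word: "left_greedy_braid n As \<Longrightarrow> braid_word n (fprod As)"
  by (induction As) (auto simp: left_greedy_braid_Cons is_frag_braid)

lemma bdvd_peq: "peq n b b' \<Longrightarrow> bdvd n a b \<Longrightarrow> bdvd n a b'"
  unfolding bdvd_def using peq_trans by blast

lemma pdvd_peq_left: "peq n a a' \<Longrightarrow> pdvd n a b \<Longrightarrow> pdvd n a' b"
  unfolding pdvd_def by (meson peq_append_right peq_sym peq_trans)

lemma bdvd_peq_left: "peq n a a' \<Longrightarrow> bdvd n a b \<Longrightarrow> bdvd n a' b"
  unfolding bdvd_def by (meson peq_append_right peq_sym peq_trans)

lemma delta_gcd_cong: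
  assumes "peq n a a'" "peq n P P'" "delta_gcd n a P"
  shows "delta_gcd n a' P'"
  using assms(3) bdvd_peq[OF assms(1)] bdvd_peq[OF assms(2)] bdvd_peq[OF peq_sym[OF assms(2)]]
    bdvd_peq_left[OF assms(1)] unfolding delta_gcd_def by blast

lemma delta_gcd_unique:
  assumes "delta_gcd n a P" "delta_gcd n a' P'" "peq n P P'" "braid_word n a" "braid_word n a'"
  shows "peq n a a'"
proof -
  have "bdvd n a a'" "bdvd n a' a"
    using assms(1,2,4,5) bdvd_peq[OF assms(3)] bdvd_peq[OF peq_sym[OF assms(3)]] unfolding delta_gcd_def by blast+
  then have "pdvd n a a'" "pdvd n a' a" using assms(4,5) by (simp_all add: bdvd_iff_pdvd)
  then show ?thesis using pdvd_antisym pdvd_length by blast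
qed

lemma delta_gcd_exists:
  assumes "braid_word n P"
  shows "\<exists>a. braid_word n a \<and> delta_gcd n a P"
proof -
  have "braid_word n (delta n)" by (simp add: braid_delta)
  then show ?thesis
    using greatest_common_braid_ldiv_exists[of "{delta n, P}" n] assms
    unfolding delta_gcd_def by (auto simp: bdvd_iff_pdvd braid_imp_pos)
qed

text \<open>The first fragments are gcds of Delta with the same braid, hence equal; cancel them and
  recurse.\<close>

lemma left_greedy_braid_unique:
  assumes "left_greedy_braid n As" "left_greedy_braid n Bs" "peq n (fprod As) (fprod Bs)"
  shows "As = Bs"
  using assms
proof (induction As arbitrary: Bs)
  case Nil
  then have "fprod Bs = []" using peq_sym[OF Nil.prems(3)] by (simp add: peq_Nil_iff)
  then show ?case using Nil.prems(2)
    by (cases Bs) (auto simp: left_greedy_braid_Cons)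
next
  case (Cons f As)
  have "fprod (f # As) \<noteq> []" using Cons.prems(1) by (simp add: left_greedy_braid_Cons)
  then have "Bs \<noteq> []" using Cons.prems(3) peq_Nil_iff fprod_simps(1) by metis
  then obtain g Bs' where Bs: "Bs = g # Bs'" by (cases Bs) auto
  have f: "is_frag n f" "is_frag n g" "left_greedy_braid n As" "left_greedy_braid n Bs'"
    using Cons.prems Bs by (auto simp: left_greedy_braid_Cons)
  have "peq n (fword f) (fword g)"
    using Cons.prems Bs
    by - (rule delta_gcd_unique[of n _ "fprod (f # As)" _ "fprod Bs"],
        auto simp: left_greedy_braid_Cons is_frag_braid)
  then have "f = g" using is_frag_eqI f by blast
  then have "peq n (fprod As) (fprod Bs')"
    using Cons.prems(3) Bs f braid_imp_pos is_frag_braid left_greedy_braid_word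
    by - (rule peq_append_cancel[of n "fword f"], auto)
  then show ?case using Cons.IH f Bs \<open>f = g\<close> by blast
qed

lemma left_greedy_braid_exists:
  assumes "braid_word n P"
  shows "\<exists>As. left_greedy_braid n As \<and> peq n (fprod As) P"
  using assms
proof (induction "length P" arbitrary: P rule: less_induct)
  case less
  show ?case
  proof (cases P)
    case Nil
    then show ?thesis by (intro exI[of _ "[]"]) simp
  next
    case (Cons h P')
    then obtain i where i: "h = Sg i" "idx_ok n i" "braid_word n P'"
      using less.prems by (cases h) auto
    obtain a where a: "braid_word n a" "delta_gcd n a P"
      using delta_gcd_exists less.prems by blast
    then obtain Q where Q: "braid_word n Q" "peq n (a @ Q) P"
      unfolding delta_gcd_def bdvd_def by blast
    \<comment> \<open>The first letter of \<open>P\<close> divides Delta too, so the gcd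
      \<open>a\<close> is nontrivial and the remainder \<open>Q\<close> is shorter.\<close>
    have "bdvd n [Sg i] (delta n)" "bdvd n [Sg i] P"
      using cofactor[OF i(2)] i Cons by (auto simp: bdvd_def)
    then have "bdvd n [Sg i] a"
      using a i unfolding delta_gcd_def by simp
    then have len: "length a \<ge> 1" using pdvd_length a by (fastforce simp: bdvd_iff_pdvd)
    then have "length Q < length P" using peq_length[OF Q(2)] by simp
    then obtain As where As: "left_greedy_braid n As" "peq n (fprod As) Q"
      using less.hyps Q(1) by blast
    let ?f = "Frag (pcls n a)"
    have f: "peq n (fword ?f) a" using fword_frag a braid_imp_pos by blast
    have prod: "peq n (fprod (?f # As)) P"
      using peq_trans[OF peq_append[OF f As(2)] Q(2)] by simp
    have "is_frag n ?f" using a unfolding is_frag_def by blast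
    moreover have "fword ?f \<noteq> []" using peq_length[OF f] len by auto
    moreover have "delta_gcd n (fword ?f) (fprod (?f # As))"
      using delta_gcd_cong[OF peq_sym[OF f] peq_sym[OF prod] a(2)] .
    ultimately have "left_greedy_braid n (?f # As)"
      using As(1) left_greedy_braid_Cons by blast
    then show ?thesis using prod by blast
  qed
qed

section \<open>Alternation of braid parts and letters x\<close>

lemma greatest_braid_ldiv_cong:
  assumes "peq n s s'" "peq n T T'" "greatest_braid_ldiv n s T"
  shows "greatest_braid_ldiv n s' T'"
  using assms(3) pdvd_peq[OF assms(1)] pdvd_peq[OF assms(2)] pdvd_peq[OF peq_sym[OF assms(2)]]
    pdvd_peq_left[OF assms(1)] unfolding greatest_braid_ldiv_def by blast

lemma greatest_braid_ldiv_unique: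
  assumes "greatest_braid_ldiv n s T" "greatest_braid_ldiv n s' T'" "peq n T T'" "braid_word n s" "braid_word n s'"
  shows "peq n s s'"
proof -
  have "pdvd n s s'" "pdvd n s' s"
    using assms(1,2,4,5) pdvd_peq[OF assms(3)] pdvd_peq[OF peq_sym[OF assms(3)]] 
    unfolding greatest_braid_ldiv_def by blast+
  then show ?thesis using pdvd_antisym pdvd_length by blast
qed

lemma greatest_braid_ldiv_exists:
  "pos_word n T \<Longrightarrow> \<exists>s. braid_word n s \<and> greatest_braid_ldiv n s T"
  using greatest_common_braid_ldiv_exists[of "{T}" n] unfolding greatest_braid_ldiv_def by simp

lemma greatest_braid_ldiv_self: "greatest_braid_ldiv n s s"
  unfolding greatest_braid_ldiv_def pdvd_def by (auto intro: exI[of _ "[]"])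

lemma min_x_ldiv_cong: "peq n T T' \<Longrightarrow> min_x_ldiv n i T \<Longrightarrow> min_x_ldiv n i T'"
  unfolding min_x_ldiv_def using pdvd_peq peq_sym by blast

lemma min_x_ldiv_unique: "min_x_ldiv n i T \<Longrightarrow> min_x_ldiv n j T \<Longrightarrow> i = j"
  unfolding min_x_ldiv_def by (meson linorder_neqE_nat)

lemma lg_tail_pos: "lg_tail n fs \<Longrightarrow> pos_word n (fprod fs)"
  by (induction rule: lg_tail.induct)
    (auto simp: min_x_ldiv_def left_greedy_braid_word braid_imp_pos)

text \<open>The leading braid part, its fragments and the next x are each determined by the product;
  left cancellation passes this on to the rest. A form with an x never equals a braid.\<close>

lemma lg_tail_unique:
  assumes "lg_tail n fs" "lg_tail n gs" "peq n (fprod fs) (fprod gs)"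
  shows "fs = gs"
  using assms
proof (induction arbitrary: gs rule: lg_tail.induct)
  case (last As)
  have br: "braid_word n (fprod gs)"
    using last left_greedy_braid_word peq_braid_iff by blast
  from last(3) have "left_greedy_braid n gs"
    by cases (use br in auto)
  then show ?case using last left_greedy_braid_unique by blast
next
  case (step As i rest)
  from step.prems(1) show ?case
  proof cases
    case last
    then have "braid_word n (fprod (As @ Xf i # rest))"
      using step.prems left_greedy_braid_word peq_braid_iff by blast
    then show ?thesis by simp
  next
    case step': (step Bs j rest')
    have br: "braid_word n (fprod As)" "braid_word n (fprod Bs)"
      using step step' left_greedy_braid_word by blast+
    have "peq n (fprod As) (fprod Bs)"
      using greatest_braid_ldiv_unique[OF step.hyps(2) step'(3)] step.prems(2) step'(1) br by simp
    then have As: "As = Bs"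
      using left_greedy_braid_unique step step' by blast
    have pos: "pos_word n (fprod (As @ Xf i # rest))"
      using lg_tail.step[OF step.hyps] lg_tail_pos by blast
    have rest: "peq n (fprod (Xf i # rest)) (fprod (Xf j # rest'))"
      using step.prems(2) step'(1) As pos by - (rule peq_append_cancel[of n "fprod As"], auto)
    have ij: "i = j"
      using min_x_ldiv_unique min_x_ldiv_cong[OF rest step.hyps(3)] step'(4) by blast
    have "peq n (fprod rest) (fprod rest')"
      using rest ij pos by - (rule peq_Cons_cancel[of n "Xg i"], auto)
    then show ?thesis using step.IH step' As ij by blast
  qed
qed

lemma lg_tail_exists:
  assumes "pos_word n W"
  shows "\<exists>fs. lg_tail n fs \<and> peq n (fprod fs) W"
  using assms
proof (induction "length W" arbitrary: W rule: less_induct)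
  case less
  obtain s where s: "braid_word n s" "greatest_braid_ldiv n s W"
    using greatest_braid_ldiv_exists less.prems by blast
  then obtain T where T: "pos_word n T" "peq n (s @ T) W"
    unfolding greatest_braid_ldiv_def pdvd_def by blast
  obtain As where As: "left_greedy_braid n As" "peq n (fprod As) s"
    using left_greedy_braid_exists s(1) by blast
  show ?case
  proof (cases T)
    case Nil
    then have "peq n (fprod As) W" using As(2) T peq_trans by auto
    then show ?thesis using lg_tail.last As(1) greatest_braid_ldiv_self by blast
  next
    case (Cons g T')
    \<comment> \<open>A sigma at the start of \<open>T\<close> would extend \<open>s\<close> to a
      longer braid divisor of \<open>W\<close>.\<close>
    have "g \<noteq> Sg i" for i
    proof
      assume g: "g = Sg i"
      then have "peq n ((s @ [Sg i]) @ T') W" "pos_word n T'" "idx_ok n i" using T Cons by auto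
      then have "pdvd n (s @ [Sg i]) s"
        using s unfolding greatest_braid_ldiv_def pdvd_def[of n _ W] by (metis braid_word_simps(1,2,5))
      then show False using pdvd_length by fastforce
    qed
    then obtain j where "g = Xg j" "idx_ok n j" "pos_word n T'"
      using T(1) Cons by (cases g) auto
    then have "\<exists>j. idx_ok n j \<and> pdvd n [Xg j] T"
      using Cons by (auto simp: pdvd_def)
    then obtain i where min: "min_x_ldiv n i T"
      unfolding min_x_ldiv_def using exists_least_iff[of "\<lambda>j. idx_ok n j \<and> pdvd n [Xg j] T"] by blast
    then obtain T1 where T1: "pos_word n T1" "peq n (Xg i # T1) T" "idx_ok n i"
      unfolding min_x_ldiv_def pdvd_def by auto
    have "length T1 < length W"
      using peq_length[OF T1(2)] peq_length[OF T(2)] by simp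
    then obtain rest where rest: "lg_tail n rest" "peq n (fprod rest) T1"
      using less.hyps T1(1) by blast
    have T': "peq n (fprod (Xf i # rest)) T"
      using peq_trans[OF peq_Cons[OF rest(2)] T1(2)] by simp
    have W: "peq n (fprod (As @ Xf i # rest)) W"
      using peq_trans[OF peq_append[OF As(2) T'] T(2)] by simp
    have "lg_tail n (As @ Xf i # rest)"
      using As(1) greatest_braid_ldiv_cong[OF peq_sym[OF As(2)] peq_sym[OF W] s(2)]
        min_x_ldiv_cong[OF peq_sym[OF T'] min] rest(1) by (rule lg_tail.step)
    then show ?thesis using W by blast
  qed
qed

text \<open>Two forms have the same exponent, both being maximal. After cancelling the power of
  Delta, \<open>geq_imp_peq\<close> brings the equality back to the positive monoid.\<close>

theorem left_greedy_form_unique_exists: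
  assumes "n \<ge> 2" "sb_word n w"
  shows "\<exists>!F. left_greedy_form n w F"
proof -
  obtain t v where tv: "pos_word n v" "geq n w (delta_pow n t @ v)"
    and max: "\<forall>s v. pos_word n v \<longrightarrow> geq n w (delta_pow n s @ v) \<longrightarrow> s \<le> t"
    using delta_normal_form_exists[OF assms] by blast
  obtain fs where fs: "lg_tail n fs" "peq n (fprod fs) v"
    using lg_tail_exists tv(1) by blast
  have w: "geq n w (delta_pow n t @ fprod fs)"
    using geq_trans[OF tv(2) geq_append[OF geq_refl peq_imp_geq[OF peq_sym[OF fs(2)]]]] .
  \<comment> \<open>Splitting off another Delta would give the exponent
    \<open>t + 1\<close>.\<close>
  have nd: "\<not> pdvd n (delta n) (fprod fs)"
  proof
    assume "pdvd n (delta n) (fprod fs)"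
    then obtain c where c: "pos_word n c" "peq n (delta n @ c) (fprod fs)"
      unfolding pdvd_def by blast
    have "geq n w (delta_pow n t @ delta n @ c)"
      using geq_trans[OF w geq_append[OF geq_refl peq_imp_geq[OF peq_sym[OF c(2)]]]] .
    also have "\<dots> = (delta_pow n t @ delta n) @ c" by simp
    also have "geq n \<dots> (delta_pow n (t + 1) @ c)"
      using delta_pow_add1 by (intro geq_append geq_refl)
    finally show False using max c(1) by force
  qed
  show ?thesis
  proof (rule ex1I[of _ "(t, fs)"])
    show "left_greedy_form n w (t, fs)"
      using fs(1) w nd max by (simp add: left_greedy_form_def)
    fix F assume F: "left_greedy_form n w F"
    obtain s gs where F_eq: "F = (s, gs)" by fastforce
    have gs: "lg_tail n gs" "geq n w (delta_pow n s @ fprod gs)" 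
      and max': "\<forall>s' v. pos_word n v \<longrightarrow> geq n w (delta_pow n s' @ v) \<longrightarrow> s' \<le> s"
      using F F_eq by (auto simp: left_greedy_form_def)
    have "s = t" using max max' gs tv lg_tail_pos by (meson order_antisym)
    then have "geq n (fprod gs) (fprod fs)"
      using geq_trans[OF geq_sym[OF gs(2)] w] delta_pow_cancel by blast
    then have "peq n (fprod gs) (fprod fs)"
      using geq_imp_peq lg_tail_pos gs(1) fs(1) by blast
    then show "F = (t, fs)" using lg_tail_unique gs(1) fs(1) F_eq \<open>s = t\<close> by blast
  qed
qed

section \<open>Right-greedy forms\<close>

fun mirror :: "factor \<Rightarrow> factor" where
  "mirror (Frag A) = Frag (rev ` A)"
| "mirror (Xf i) = Xf i"

lemma mirror_mirror [simp]: "mirror (mirror f) = f"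
  by (cases f) (simp_all add: image_image)

definition reflect :: "factor list \<Rightarrow> factor list" where
  "reflect fs = rev (map mirror fs)"

lemma reflect_simps [simp]:
  "reflect [] = []" "reflect (f # fs) = reflect fs @ [mirror f]" "reflect (fs @ gs) = reflect gs @ reflect fs"
  by (simp_all add: reflect_def)

lemma reflect_reflect [simp]: "reflect (reflect fs) = fs"
  by (simp add: reflect_def rev_map comp_def)

lemma peq_rev_iff: "peq n (rev u) (rev v) \<longleftrightarrow> peq n u v"
  using peq_rev[of n u v] peq_rev[of n "rev u" "rev v"] by auto

lemma geq_rev_iff: "geq n (rev u) (rev v) \<longleftrightarrow> geq n u v"
  using geq_rev[of n u v] geq_rev[of n "rev u" "rev v"] by auto

lemma all_rev: "(\<forall>u. P (rev u)) \<longleftrightarrow> (\<forall>u. P u)"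
  by (metis rev_rev_ident)

lemma ex_rev: "(\<exists>u. P (rev u)) \<longleftrightarrow> (\<exists>u. P u)"
  by (metis rev_rev_ident)

lemma pcls_rev: "pcls n (rev a) = rev ` pcls n a"
proof -
  have "v \<in> rev ` pcls n a" if "v \<in> pcls n (rev a)" for v
    using that peq_rev[of n "rev a" v] by (intro image_eqI[of _ _ "rev v"]) (auto simp: pcls_def)
  then show ?thesis by (auto simp: pcls_def peq_rev_iff)
qed

text \<open>Only \<open>peq\<close> can hold: representatives of a class and of its mirror image are
  chosen independently.\<close>

lemma is_frag_mirror:
  assumes "is_frag n f"
  shows "is_frag n (mirror f)" "peq n (fword (mirror f)) (rev (fword f))"
proof -
  obtain a where a: "braid_word n a" "f = Frag (pcls n a)" using assms unfolding is_frag_def by blast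
  have eq: "mirror f = Frag (pcls n (rev a))" using a by (simp add: pcls_rev)
  then show "is_frag n (mirror f)" using a unfolding is_frag_def by (metis braid_word_rev)
  have "peq n (fword (mirror f)) (rev a)"
    using eq fword_frag[of n "rev a"] a by (simp add: braid_imp_pos)
  also have "peq n (rev a) (rev (fword f))"
    using a peq_rev[OF peq_sym[OF fword_frag[of n a]]] by (simp add: braid_imp_pos)
  finally show "peq n (fword (mirror f)) (rev (fword f))" .
qed

text \<open>Excludes \<open>Frag\<close> of arbitrary sets, for which the chosen word of the mirror
  image need not be related to the reversed chosen word.\<close>

definition wf_factors :: "nat \<Rightarrow> factor list \<Rightarrow> bool" where
  "wf_factors n fs \<longleftrightarrow> (\<forall>f\<in>set fs. is_frag n f \<or> (\<exists>i. f = Xf i))"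

lemma wf_factors_simps [simp]:
  "wf_factors n []"
  "wf_factors n (f # fs) \<longleftrightarrow> (is_frag n f \<or> (\<exists>i. f = Xf i)) \<and> wf_factors n fs"
  "wf_factors n (fs @ gs) \<longleftrightarrow> wf_factors n fs \<and> wf_factors n gs"
  by (auto simp: wf_factors_def)

lemma fprod_reflect: "wf_factors n fs \<Longrightarrow> peq n (fprod (reflect fs)) (rev (fprod fs))"
proof (induction fs)
  case (Cons f fs)
  have "peq n (fword (mirror f)) (rev (fword f))"
    using Cons.prems is_frag_mirror by auto
  then show ?case using Cons peq_append by simp
qed simp

lemma rbdvd_iff_bdvd_rev: "rbdvd n a b \<longleftrightarrow> bdvd n (rev a) (rev b)"
proof -
  have "rbdvd n a b \<longleftrightarrow> (\<exists>c. braid_word n (rev c) \<and> peq n (rev (c @ a)) (rev b))"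
    unfolding rbdvd_def by (simp only: peq_rev_iff braid_word_rev)
  also have "\<dots> \<longleftrightarrow> bdvd n (rev a) (rev b)"
    unfolding bdvd_def rev_append by (rule ex_rev)
  finally show ?thesis .
qed

lemma rpdvd_iff_pdvd_rev: "rpdvd n a b \<longleftrightarrow> pdvd n (rev a) (rev b)"
proof -
  have "rpdvd n a b \<longleftrightarrow> (\<exists>c. pos_word n (rev c) \<and> peq n (rev (c @ a)) (rev b))"
    unfolding rpdvd_def by (simp only: peq_rev_iff pos_word_rev)
  also have "\<dots> \<longleftrightarrow> pdvd n (rev a) (rev b)"
    unfolding pdvd_def rev_append by (rule ex_rev)
  finally show ?thesis .
qed

lemma greatest_braid_rdiv_iff: "greatest_braid_rdiv n s T \<longleftrightarrow> greatest_braid_ldiv n (rev s) (rev T)"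
  unfolding greatest_braid_rdiv_def greatest_braid_ldiv_def rpdvd_iff_pdvd_rev
  using all_rev[of "\<lambda>s'. braid_word n s' \<longrightarrow> pdvd n s' (rev T) \<longrightarrow> pdvd n s' (rev s)"] by simp

lemma min_x_rdiv_iff: "min_x_rdiv n i T \<longleftrightarrow> min_x_ldiv n i (rev T)"
  unfolding min_x_rdiv_def min_x_ldiv_def rpdvd_iff_pdvd_rev by simp

lemma bdvd_rev_delta: "bdvd n a (rev (delta n)) \<longleftrightarrow> bdvd n a (delta n)"
  using bdvd_peq delta_rev[of n n] peq_sym by blast

lemma right_greedy_braid_Nil [simp]: "right_greedy_braid n []"
  by (simp add: right_greedy_braid_def)

text \<open>Counterpart of \<open>left_greedy_braid_Cons\<close>; the clause at \<open>j\<close>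
  sees only a prefix, so the recursion runs from the end of the list.\<close>

lemma right_greedy_braid_snoc:
  "right_greedy_braid n (As @ [f]) \<longleftrightarrow>
     is_frag n f \<and> fword f \<noteq> [] \<and> delta_gcd n (rev (fword f)) (rev (fprod (As @ [f]))) \<and> right_greedy_braid n As"
proof -
  have gcd: "delta_gcd n (rev a) (rev P) \<longleftrightarrow> rbdvd n a (delta n) \<and> rbdvd n a P \<and>
     (\<forall>b. braid_word n b \<longrightarrow> rbdvd n b (delta n) \<longrightarrow> rbdvd n b P \<longrightarrow> rbdvd n b a)" for a P
    unfolding delta_gcd_def rbdvd_iff_bdvd_rev bdvd_rev_delta
    using all_rev[of "\<lambda>b. braid_word n b \<longrightarrow> bdvd n b (delta n) \<longrightarrow> bdvd n b (rev P) \<longrightarrow> bdvd n b (rev a)"]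
    by simp
  show ?thesis
    unfolding right_greedy_braid_def gcd
    by (auto simp: All_less_Suc nth_append peq_Nil_iff)
qed

lemma right_greedy_braid_wf: "right_greedy_braid n As \<Longrightarrow> wf_factors n As"
  by (auto simp: right_greedy_braid_def wf_factors_def)

lemma left_greedy_braid_wf: "left_greedy_braid n As \<Longrightarrow> wf_factors n As"
  by (auto simp: left_greedy_braid_def wf_factors_def)

lemma left_greedy_braid_reflect:
  "\<forall>f\<in>set As. is_frag n f \<Longrightarrow> left_greedy_braid n (reflect As) \<longleftrightarrow> right_greedy_braid n As"
proof (induction As rule: rev_induct)
  case (snoc f As)
  have f: "is_frag n f" "is_frag n (mirror f)" "peq n (fword (mirror f)) (rev (fword f))"
    using snoc.prems is_frag_mirror by auto
  have "wf_factors n (As @ [f])" using snoc.prems by (auto simp: wf_factors_def)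
  from fprod_reflect[OF this] have prod: "peq n (fprod (mirror f # reflect As)) (rev (fprod (As @ [f])))"
    by simp
  have "delta_gcd n (fword (mirror f)) (fprod (mirror f # reflect As)) \<longleftrightarrow>
      delta_gcd n (rev (fword f)) (rev (fprod (As @ [f])))"
    using delta_gcd_cong[OF f(3) prod] delta_gcd_cong[OF peq_sym[OF f(3)] peq_sym[OF prod]] by blast
  moreover have "fword (mirror f) = [] \<longleftrightarrow> fword f = []"
    using peq_length[OF f(3)] by auto
  ultimately show ?case
    using snoc f by (simp add: left_greedy_braid_Cons right_greedy_braid_snoc del: fprod_simps)
qed simp

lemma greedy_braid_reflect:
  "right_greedy_braid n As \<Longrightarrow> left_greedy_braid n (reflect As)"
  "left_greedy_braid n As \<Longrightarrow> right_greedy_braid n (reflect As)"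
proof -
  show "right_greedy_braid n As \<Longrightarrow> left_greedy_braid n (reflect As)"
    by (subst left_greedy_braid_reflect) (auto simp: right_greedy_braid_def)
  assume As: "left_greedy_braid n As"
  then have "\<forall>f\<in>set (reflect As). is_frag n f"
    by (auto simp: reflect_def left_greedy_braid_def is_frag_mirror)
  from left_greedy_braid_reflect[OF this] show "right_greedy_braid n (reflect As)" using As by simp
qed

lemma rg_tail_reflect: "rg_tail n fs \<Longrightarrow> wf_factors n fs \<and> lg_tail n (reflect fs)"
proof (induction rule: rg_tail.induct)
  case (last As)
  then show ?case
    using right_greedy_braid_wf greedy_braid_reflect greatest_braid_ldiv_self lg_tail.last by blast
next
  case (step As rest i)
  have wf: "wf_factors n (rest @ Xf i # As)" "wf_factors n (rest @ [Xf i])"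
    using step right_greedy_braid_wf by auto
  have "lg_tail n (reflect As @ Xf i # reflect rest)"
  proof (rule lg_tail.step)
    show "left_greedy_braid n (reflect As)" using greedy_braid_reflect step by blast
    have "peq n (rev (fprod As)) (fprod (reflect As))"
      using fprod_reflect step(1) right_greedy_braid_wf peq_sym by blast
    moreover have "peq n (rev (fprod (rest @ Xf i # As))) (fprod (reflect As @ Xf i # reflect rest))"
      using peq_sym[OF fprod_reflect[OF wf(1)]] by simp
    ultimately show "greatest_braid_ldiv n (fprod (reflect As)) (fprod (reflect As @ Xf i # reflect rest))"
      using greatest_braid_ldiv_cong step(2) greatest_braid_rdiv_iff by blast
    have "peq n (rev (fprod (rest @ [Xf i]))) (fprod (Xf i # reflect rest))"
      using peq_sym[OF fprod_reflect[OF wf(2)]] by simp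
    then show "min_x_ldiv n i (fprod (Xf i # reflect rest))"
      using min_x_ldiv_cong step(3) min_x_rdiv_iff by blast
    show "lg_tail n (reflect rest)" using step by blast
  qed
  then show ?case using wf by simp
qed

lemma lg_tail_reflect: "lg_tail n fs \<Longrightarrow> wf_factors n fs \<and> rg_tail n (reflect fs)"
proof (induction rule: lg_tail.induct)
  case (last As)
  have "greatest_braid_rdiv n s s" for s
    by (simp add: greatest_braid_rdiv_iff greatest_braid_ldiv_self)
  then show ?case
    using last left_greedy_braid_wf greedy_braid_reflect rg_tail.last by blast
next
  case (step As i rest)
  have wf: "wf_factors n (As @ Xf i # rest)" "wf_factors n (Xf i # rest)"
    using step left_greedy_braid_wf by auto
  have "rg_tail n (reflect rest @ Xf i # reflect As)"
  proof (rule rg_tail.step)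
    show "right_greedy_braid n (reflect As)" using greedy_braid_reflect step by blast
    have "peq n (fprod As) (rev (fprod (reflect As)))"
      using fprod_reflect[OF left_greedy_braid_wf[OF step(1)]] peq_rev peq_sym by fastforce
    moreover have "peq n (fprod (As @ Xf i # rest)) (rev (fprod (reflect rest @ Xf i # reflect As)))"
      using peq_sym[OF peq_rev[OF fprod_reflect[OF wf(1)]]] by simp
    ultimately show "greatest_braid_rdiv n (fprod (reflect As)) (fprod (reflect rest @ Xf i # reflect As))"
      using greatest_braid_ldiv_cong step(2) greatest_braid_rdiv_iff by blast
    have "peq n (fprod (Xf i # rest)) (rev (fprod (reflect rest @ [Xf i])))"
      using peq_sym[OF peq_rev[OF fprod_reflect[OF wf(2)]]] by simp
    then show "min_x_rdiv n i (fprod (reflect rest @ [Xf i]))"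
      using min_x_ldiv_cong step(3) min_x_rdiv_iff by blast
    show "rg_tail n (reflect rest)" using step by blast
  qed
  then show ?case using wf by simp
qed

lemma rg_tail_iff: "rg_tail n fs \<longleftrightarrow> lg_tail n (reflect fs)"
  using rg_tail_reflect lg_tail_reflect reflect_reflect by metis

section \<open>Reversing whole forms\<close>

lemma rev_wpower: "rev (wpower u k) = wpower (rev u) k"
  by (simp add: rev_concat)

lemma geq_wpower: "geq n u v \<Longrightarrow> geq n (wpower u k) (wpower v k)"
  by (induction k) (auto intro: geq_append)

lemma delta_pow_rev: "geq n (rev (delta_pow n t)) (delta_pow n t)"
proof -
  let ?D = "delta n" and ?E = "rev (map ginv (delta n))"
  note inv = geq_inverse_word[OF braid_delta[OF order_refl[of n]]]
  have D: "geq n (rev ?D) ?D" by (simp add: delta_rev peq_imp_geq)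
  \<comment> \<open>Uniqueness of inverses: Delta is its own reversal, so both \<open>?E\<close> and
    \<open>rev ?E\<close> invert it, and this product equals each of them.\<close>
  have "geq n (rev ?E @ ?D @ ?E) (rev ?E @ [])"
    using inv(1) by (rule geq_append_left)
  moreover have "geq n (rev ?E @ ?D) (rev ?E @ rev ?D)"
    using geq_sym[OF D] by (rule geq_append_left)
  then have "geq n (rev ?E @ ?D) []"
    using geq_trans geq_rev[OF inv(1)] by simp
  from geq_append_right[OF this, of ?E] have "geq n (rev ?E @ ?D @ ?E) ?E" by simp
  ultimately have "geq n (rev ?E) ?E" using geq_trans geq_sym by (metis append_Nil2)
  then show ?thesis
    using D geq_wpower unfolding delta_pow_def by (auto simp: rev_wpower simp del: rev_rev_ident)
qed

lemma geq_delta_pow_rev: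
  assumes "geq n u' (rev u)"
  shows "geq n (rev w) (delta_pow n t @ u') \<longleftrightarrow> geq n w (u @ delta_pow n t)"
proof -
  have "geq n (delta_pow n t @ u') (rev (u @ delta_pow n t))"
    using geq_append[OF geq_sym[OF delta_pow_rev] assms] by simp
  then show ?thesis using geq_rev_iff geq_trans geq_sym by metis
qed

text \<open>Reversal carries the power of Delta from the right end to the left one and keeps it up
  to \<open>geq\<close>, so all clauses correspond.\<close>

lemma right_greedy_form_iff:
  "right_greedy_form n w (t, fs) \<longleftrightarrow> left_greedy_form n (rev w) (t, reflect fs)"
proof (cases "rg_tail n fs")
  case True
  have prod: "peq n (fprod (reflect fs)) (rev (fprod fs))"
    using True rg_tail_reflect fprod_reflect by blast
  have "rpdvd n (delta n) (fprod fs) \<longleftrightarrow> pdvd n (delta n) (fprod (reflect fs))"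
    unfolding rpdvd_iff_pdvd_rev
    using pdvd_peq[OF prod] pdvd_peq[OF peq_sym[OF prod]] pdvd_peq_left delta_rev[of n n] peq_sym by blast
  moreover have "(\<forall>v. pos_word n v \<longrightarrow> geq n w (v @ delta_pow n s) \<longrightarrow> s \<le> t) \<longleftrightarrow>
      (\<forall>v. pos_word n v \<longrightarrow> geq n (rev w) (delta_pow n s @ v) \<longrightarrow> s \<le> t)" for s
    using all_rev[of "\<lambda>v. pos_word n v \<longrightarrow> geq n (rev w) (delta_pow n s @ v) \<longrightarrow> s \<le> t"]
    by (simp add: geq_delta_pow_rev[OF geq_refl])
  ultimately show ?thesis
    using True rg_tail_iff geq_delta_pow_rev[OF peq_imp_geq[OF prod]]
    by (simp add: right_greedy_form_def left_greedy_form_def)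
qed (simp add: right_greedy_form_def left_greedy_form_def rg_tail_iff)

theorem theorem2p2:
  fixes n :: nat and w :: "gen list"
  assumes "n \<ge> 2" and "sb_word n w"
  shows "(\<exists>!F. left_greedy_form n w F) \<and> (\<exists>!F. right_greedy_form n w F)"
proof
  show "\<exists>!F. left_greedy_form n w F"
    using left_greedy_form_unique_exists[OF assms] .
  \<comment> \<open>The right-handed half is the left-handed one for \<open>rev w\<close>, carried
    over by the involution \<open>reflect\<close>.\<close>
  have "\<exists>!F. left_greedy_form n (rev w) F"
    using left_greedy_form_unique_exists[of n "rev w"] assms by simp
  then obtain t fs where F: "left_greedy_form n (rev w) (t, fs)"
    and unique: "\<And>F. left_greedy_form n (rev w) F \<Longrightarrow> F = (t, fs)"
    by (metis surj_pair)
  show "\<exists>!F. right_greedy_form n w F"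
  proof (rule ex1I[of _ "(t, reflect fs)"])
    show "right_greedy_form n w (t, reflect fs)"
      using F by (simp add: right_greedy_form_iff)
    fix G assume G: "right_greedy_form n w G"
    obtain s gs where G_eq: "G = (s, gs)" by fastforce
    then have "(s, reflect gs) = (t, fs)"
      using G unique by (simp add: right_greedy_form_iff)
    then show "G = (t, reflect fs)" using G_eq reflect_reflect by auto
  qed
qed

end
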